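(* Let $\Omega\subset\mathbb{R}^N$ be a bounded open set, $0<s<1$, and let $p,q,r\in[2,\infty)$ satisfy $p<q$ and $r>\frac{N(q-p)}{sp}$. Let $u\in D(\partial_V\Phi)$ and let $J_\mu^\phi:=(I+\mu\,\partial_H\phi)^{-1}$, $\mu>0$. Then $$J_\mu^\phi u\in D(\partial_V\Phi),\qquad \partial_H\phi_\mu(u)\in V,\qquad v_\mu:=|J_\mu^\phi u|^{\frac{r-2}{p}}J_\mu^\phi u\in W_0^{s,p}(\overline\Omega).$$ In particular, if $u\in D(\partial_V\Phi^\sigma)$, then there exists a positive constant $\beta$ independent of $\mu$ such that for all $g\in\partial_V\Phi^\sigma(u)$, $$\frac{\beta C_{N,p,s}}2\int_{\mathbb{R}^N}\int_{\mathbb{R}^N}\frac{|v_\mu(x)-v_\mu(y)|^p}{|x-y|^{N+sp}}dxdy\le\langle g,\partial_H\phi_\mu(u)\rangle_{V^*,V}.$$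
   Context: $C_{N,p,s}=\frac{s2^{2s}\Gamma\left(\frac{ps+p+N-2}{2}\right)}{\pi^{N/2}\Gamma(1-s)}$. $W_0^{s,p}(\overline\Omega)=\{u\in W^{s,p}(\mathbb{R}^N):u=0\text{ a.e. on }\mathbb{R}^N\setminus\Omega\}$ with norm $\||u|\|_{W_0^{s,p}(\overline\Omega)}=\left(\frac{C_{N,p,s}}2\int_{\mathbb{R}^N}\int_{\mathbb{R}^N}\frac{|u(x)-u(y)|^p}{|x-y|^{N+sp}}dxdy\right)^{1/p}$. $V:=W_0^{s,p}(\overline\Omega)\cap L^r(\Omega)$ with norm $\|u\|_V=(\|u\|_{L^r(\Omega)}^2+\||u|\|^2_{W_0^{s,p}(\overline\Omega)})^{1/2}$; $V^*$ its dual; $H:=L^2(\Omega)$, $V\hookrightarrow H\hookrightarrow V^*$. For a functional $\varphi$ on a reflexive Banach space $X$ with values in $(-\infty,\infty]$, $\partial_X\varphi(x_0)=\{x^*\in X^*:x^*(x-x_0)\le\varphi(x)-\varphi(x_0)\ \forall x\in X\}$ and $D(\partial_X\varphi)=\{x:\partial_X\varphi(x)\ne\emptyset\}$ (for $X=H$, $H^*$ is identified with $H$). For $\varphi$ proper, convex, l.s.c. on $H$, its Moreau–Yosida approximation is $\varphi_\mu(u)=\inf_{v\in H}\{\frac1{2\mu}\|u-v\|_H^2+\varphi(v)\}$; $\partial_H\varphi_\mu=\frac1\mu(I-(I+\mu\partial_H\varphi)^{-1})$. $\Phi:V\to[0,\infty)$, $\Phi(u)=\frac{C_{N,p,s}}{2p}\int_{\mathbb{R}^N}\int_{\mathbb{R}^N}\frac{|u(x)-u(y)|^p}{|x-y|^{N+sp}}dxdy$,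 with $D(\partial_V\Phi)=V$. $\phi:L^2(\Omega)\to[0,\infty]$, $\phi(u)=\frac1r\int_\Omega|u|^rdx$ if $u\in L^r(\Omega)$, $+\infty$ otherwise. Given a fixed $u_0\in V$, $\sigma:=\phi(u_0)+1$, $V_\sigma=\{v\in V:\phi(v)\le\sigma\}$, and $\Phi^\sigma:V\to[0,\infty]$ equals $\Phi$ on $V_\sigma$ and $+\infty$ elsewhere; $D(\partial_V\Phi^\sigma)=V_\sigma$. *)

theory Defs
  imports "HOL-Analysis.Analysis"
begin

text \<open>
  The space \<open>\<real>\<^sup>N\<close> is a type of class \<^class>\<open>euclidean_space\<close>, so \<open>N = DIM('a)\<close>. Elements
  of all function spaces below are Borel representatives, and two representatives that agree almost
  everywhere stand for the same element. A function on \<open>\<Omega>\<close> is identified with its extension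
  by zero; this is how \<open>L\<^sup>q(\<Omega>)\<close> and subspaces of \<open>W\<^sup>s\<^sup>,\<^sup>p(\<real>\<^sup>N)\<close> are compared.
\<close>

definition Lebesgue_space :: "'a::euclidean_space set \<Rightarrow> real \<Rightarrow> ('a \<Rightarrow> real) set" where
  "Lebesgue_space \<Omega> q =
     {u \<in> borel_measurable borel.
        (AE x in lborel. x \<notin> \<Omega> \<longrightarrow> u x = 0) \<and>
        set_integrable lborel \<Omega> (\<lambda>x. \<bar>u x\<bar> powr q)}"

definition Lebesgue_norm :: "'a::euclidean_space set \<Rightarrow> real \<Rightarrow> ('a \<Rightarrow> real) \<Rightarrow> real" where
  "Lebesgue_norm \<Omega> q u = (LINT x:\<Omega>|lborel. \<bar>u x\<bar> powr q) powr (1 / q)"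

definition frac_const :: "nat \<Rightarrow> real \<Rightarrow> real \<Rightarrow> real" where
  "frac_const N p s =
     s * 2 powr (2 * s) * Gamma ((p * s + p + real N - 2) / 2)
       / (pi powr (real N / 2) * Gamma (1 - s))"

definition gagliardo_ennreal :: "real \<Rightarrow> real \<Rightarrow> ('a::euclidean_space \<Rightarrow> real) \<Rightarrow> ennreal" where
  "gagliardo_ennreal s p u =
     (\<integral>\<^sup>+x. (\<integral>\<^sup>+y. ennreal (\<bar>u x - u y\<bar> powr p / norm (x - y) powr (real DIM('a) + s * p))
        \<partial>lborel) \<partial>lborel)"

text \<open>The value \<open>0\<close> for an infinite double integral is never meant: this is only applied to
  functions in \<open>W\<^sup>s\<^sup>,\<^sup>p(\<real>\<^sup>N)\<close>.\<close>

definition gagliardo :: "real \<Rightarrow> real \<Rightarrow> ('a::euclidean_space \<Rightarrow> real) \<Rightarrow> real" where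
  "gagliardo s p u = enn2real (gagliardo_ennreal s p u)"

definition frac_Sobolev :: "real \<Rightarrow> real \<Rightarrow> ('a::euclidean_space \<Rightarrow> real) set" where
  "frac_Sobolev s p = {u \<in> Lebesgue_space UNIV p. gagliardo_ennreal s p u < \<infinity>}"

definition frac_Sobolev0 ::
  "'a::euclidean_space set \<Rightarrow> real \<Rightarrow> real \<Rightarrow> ('a \<Rightarrow> real) set" where
  "frac_Sobolev0 \<Omega> s p = {u \<in> frac_Sobolev s p. AE x in lborel. x \<notin> \<Omega> \<longrightarrow> u x = 0}"

definition frac_Sobolev0_norm :: "real \<Rightarrow> real \<Rightarrow> ('a::euclidean_space \<Rightarrow> real) \<Rightarrow> real" where
  "frac_Sobolev0_norm s p u = (frac_const DIM('a) p s / 2 * gagliardo s p u) powr (1 / p)"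

definition V_space ::
  "'a::euclidean_space set \<Rightarrow> real \<Rightarrow> real \<Rightarrow> real \<Rightarrow> ('a \<Rightarrow> real) set" where
  "V_space \<Omega> s p r = frac_Sobolev0 \<Omega> s p \<inter> Lebesgue_space \<Omega> r"

definition V_norm ::
  "'a::euclidean_space set \<Rightarrow> real \<Rightarrow> real \<Rightarrow> real \<Rightarrow> ('a \<Rightarrow> real) \<Rightarrow> real" where
  "V_norm \<Omega> s p r u = sqrt ((Lebesgue_norm \<Omega> r u)\<^sup>2 + (frac_Sobolev0_norm s p u)\<^sup>2)"

abbreviation H_space :: "'a::euclidean_space set \<Rightarrow> ('a \<Rightarrow> real) set" where
  "H_space \<Omega> \<equiv> Lebesgue_space \<Omega> 2"

abbreviation H_norm :: "'a::euclidean_space set \<Rightarrow> ('a \<Rightarrow> real) \<Rightarrow> real" where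
  "H_norm \<Omega> \<equiv> Lebesgue_norm \<Omega> 2"

text \<open>The functionals below are total HOL functions; only their values on \<open>X\<close> matter. The norm
  bound makes them independent of the choice of representatives.\<close>

definition dual_space ::
  "('a \<Rightarrow> real) set \<Rightarrow> (('a \<Rightarrow> real) \<Rightarrow> real) \<Rightarrow> (('a \<Rightarrow> real) \<Rightarrow> real) set" where
  "dual_space X nrm =
     {g. (\<forall>u\<in>X. \<forall>v\<in>X. g (\<lambda>x. u x + v x) = g u + g v) \<and>
         (\<forall>c. \<forall>u\<in>X. g (\<lambda>x. c * u x) = c * g u) \<and>
         (\<exists>K. \<forall>u\<in>X. \<bar>g u\<bar> \<le> K * nrm u)}"

text \<open>The condition \<open>\<phi> x0 \<noteq> \<infinity>\<close> is automatic for proper \<open>\<phi>\<close>; it is stated because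
  \<open>\<infinity> - \<infinity> = \<infinity>\<close> in \<^typ>\<open>ereal\<close>.\<close>

definition subdiff ::
  "('a \<Rightarrow> real) set \<Rightarrow> (('a \<Rightarrow> real) \<Rightarrow> real) \<Rightarrow> (('a \<Rightarrow> real) \<Rightarrow> ereal) \<Rightarrow>
   ('a \<Rightarrow> real) \<Rightarrow> (('a \<Rightarrow> real) \<Rightarrow> real) set" where
  "subdiff X nrm \<phi> x0 =
     {g \<in> dual_space X nrm.
        \<phi> x0 \<noteq> \<infinity> \<and> (\<forall>x\<in>X. ereal (g (\<lambda>t. x t - x0 t)) \<le> \<phi> x - \<phi> x0)}"

definition subdiff_dom ::
  "('a \<Rightarrow> real) set \<Rightarrow> (('a \<Rightarrow> real) \<Rightarrow> real) \<Rightarrow> (('a \<Rightarrow> real) \<Rightarrow> ereal) \<Rightarrow>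
   ('a \<Rightarrow> real) set" where
  "subdiff_dom X nrm \<phi> = {x \<in> X. subdiff X nrm \<phi> x \<noteq> {}}"

text \<open>The subdifferential in \<open>H = L\<^sup>2(\<Omega>)\<close>, with the dual of \<open>H\<close> identified with \<open>H\<close> through the
  inner product.\<close>

definition subdiff_H ::
  "'a::euclidean_space set \<Rightarrow> (('a \<Rightarrow> real) \<Rightarrow> ereal) \<Rightarrow> ('a \<Rightarrow> real) \<Rightarrow> ('a \<Rightarrow> real) set" where
  "subdiff_H \<Omega> \<phi> u =
     {w \<in> H_space \<Omega>.
        (\<lambda>h. LINT x:\<Omega>|lborel. w x * h x) \<in> subdiff (H_space \<Omega>) (H_norm \<Omega>) \<phi> u}"

text \<open>For proper, convex, l.s.c. \<open>\<phi>\<close> the resolvent is single-valued on \<open>H\<close>, that is,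
  the function chosen below exists and is unique up to equality almost everywhere.\<close>

definition resolvent_H ::
  "'a::euclidean_space set \<Rightarrow> (('a \<Rightarrow> real) \<Rightarrow> ereal) \<Rightarrow> real \<Rightarrow> ('a \<Rightarrow> real) \<Rightarrow> ('a \<Rightarrow> real)" where
  "resolvent_H \<Omega> \<phi> \<mu> u =
     (SOME v. v \<in> H_space \<Omega> \<and>
        (\<exists>\<xi>\<in>subdiff_H \<Omega> \<phi> v. AE x in lborel. u x = v x + \<mu> * \<xi> x))"

definition moreau_yosida ::
  "'a::euclidean_space set \<Rightarrow> (('a \<Rightarrow> real) \<Rightarrow> ereal) \<Rightarrow> real \<Rightarrow> ('a \<Rightarrow> real) \<Rightarrow> ereal" where
  "moreau_yosida \<Omega> \<phi> \<mu> u =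
     (INF v\<in>H_space \<Omega>. ereal (1 / (2 * \<mu>) * (H_norm \<Omega> (\<lambda>x. u x - v x))\<^sup>2) + \<phi> v)"

text \<open>The single-valued \<open>\<partial>\<^sub>H\<phi>\<^sub>\<mu>\<close>, read as a map: the subdifferential of \<open>\<phi>\<^sub>\<mu>\<close> at a
  point of \<open>H\<close> has exactly one element up to equality almost everywhere.\<close>

definition moreau_yosida_deriv ::
  "'a::euclidean_space set \<Rightarrow> (('a \<Rightarrow> real) \<Rightarrow> ereal) \<Rightarrow> real \<Rightarrow> ('a \<Rightarrow> real) \<Rightarrow> ('a \<Rightarrow> real)" where
  "moreau_yosida_deriv \<Omega> \<phi> \<mu> u = (SOME w. w \<in> subdiff_H \<Omega> (moreau_yosida \<Omega> \<phi> \<mu>) u)"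

text \<open>The following two functionals are \<open>\<Phi>\<close> (on \<open>V\<close>) and \<open>\<phi>\<close> (on \<open>H\<close>).\<close>

definition frac_energy :: "real \<Rightarrow> real \<Rightarrow> ('a::euclidean_space \<Rightarrow> real) \<Rightarrow> ereal" where
  "frac_energy s p u = ereal (frac_const DIM('a) p s / (2 * p) * gagliardo s p u)"

definition power_energy ::
  "'a::euclidean_space set \<Rightarrow> real \<Rightarrow> ('a \<Rightarrow> real) \<Rightarrow> ereal" where
  "power_energy \<Omega> r u =
     (if u \<in> Lebesgue_space \<Omega> r then ereal (1 / r * (LINT x:\<Omega>|lborel. \<bar>u x\<bar> powr r)) else \<infinity>)"

definition V_sublevel ::
  "'a::euclidean_space set \<Rightarrow> real \<Rightarrow> real \<Rightarrow> real \<Rightarrow> ereal \<Rightarrow> ('a \<Rightarrow> real) set" where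
  "V_sublevel \<Omega> s p r \<sigma> = {v \<in> V_space \<Omega> s p r. power_energy \<Omega> r v \<le> \<sigma>}"

definition frac_energy_trunc ::
  "'a::euclidean_space set \<Rightarrow> real \<Rightarrow> real \<Rightarrow> real \<Rightarrow> ereal \<Rightarrow> ('a \<Rightarrow> real) \<Rightarrow> ereal" where
  "frac_energy_trunc \<Omega> s p r \<sigma> u = (if u \<in> V_sublevel \<Omega> s p r \<sigma> then frac_energy s p u else \<infinity>)"

text \<open>\<open>v\<^sub>\<mu> = |J u|\<^bsup>(r-2)/p\<^esup> J u\<close>. For \<open>r = 2\<close> the HOL convention \<open>0 powr 0 = 0\<close> is harmless
  because of the second factor.\<close>

definition resolvent_power ::
  "'a::euclidean_space set \<Rightarrow> real \<Rightarrow> real \<Rightarrow> real \<Rightarrow> ('a \<Rightarrow> real) \<Rightarrow> ('a \<Rightarrow> real)" where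
  "resolvent_power \<Omega> p r \<mu> u =
     (\<lambda>x. \<bar>resolvent_H \<Omega> (power_energy \<Omega> r) \<mu> u x\<bar> powr ((r - 2) / p)
            * resolvent_H \<Omega> (power_energy \<Omega> r) \<mu> u x)"

end

theory Submission imports Defs begin

text \<open>
  The resolvent acts pointwise: \<open>J\<^sub>\<mu>\<^sup>\<phi> u\<close> is \<open>j \<circ> u\<close>, where \<open>j\<close> inverts \<open>t + \<mu> \<bar>t\<bar>\<^bsup>r-2\<^esup> t\<close>, and
  \<open>\<partial>\<^sub>H\<phi>\<^sub>\<mu>(u) = (u - J\<^sub>\<mu>\<^sup>\<phi> u) / \<mu>\<close>. Both are Lipschitz functions of \<open>u\<close>, hence in \<open>V\<close>, and \<open>\<Phi>\<close> has a
  subgradient at every point of \<open>V\<close>. Testing \<open>g \<in> \<partial>\<^sub>V\<Phi>\<^sup>\<sigma>(u)\<close> with \<open>J\<^sub>\<mu>\<^sup>\<phi> u\<close>, which lies in \<open>V\<^sub>\<sigma>\<close> because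
  \<open>\<bar>j(t)\<bar> \<le> \<bar>t\<bar>\<close>, gives \<open>\<mu> g(\<partial>\<^sub>H\<phi>\<^sub>\<mu>(u)) \<ge> \<Phi>(u) - \<Phi>(J\<^sub>\<mu>\<^sup>\<phi> u)\<close>. The right-hand side is bounded below under
  the integral: by convexity of \<open>\<bar>t\<bar>\<^sup>p\<close> its integrand dominates
  \<open>\<bar>a - b\<bar>\<^bsup>p-2\<^esup> (a - b) (\<bar>a\<bar>\<^bsup>r-2\<^esup> a - \<bar>b\<bar>\<^bsup>r-2\<^esup> b)\<close> times \<open>\<mu>\<close>, with \<open>a, b\<close> the values of \<open>J\<^sub>\<mu>\<^sup>\<phi> u\<close> at \<open>x, y\<close>,
  and that in turn dominates a multiple of the \<open>p\<close>-th power of the difference of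
  \<open>\<bar>a\<bar>\<^bsup>(r-2)/p\<^esup> a\<close> and \<open>\<bar>b\<bar>\<^bsup>(r-2)/p\<^esup> b\<close>.
\<close>

subsection \<open>Pointwise inequalities and the scalar resolvent\<close>

text \<open>The odd power of order \<open>a + 1\<close>. Exponent \<open>r - 2\<close> gives the
  derivative of \<open>\<bar>t\<bar> powr r / r\<close>, exponent \<open>p - 2\<close> that of
  \<open>\<bar>t\<bar> powr p / p\<close>, and \<open>(r - 2) / p\<close> the map that produces
  v_\<mu>.\<close>

definition signed_powr :: "real \<Rightarrow> real \<Rightarrow> real" where
  "signed_powr a t = \<bar>t\<bar> powr a * t"

lemma signed_powr_0 [simp]: "signed_powr a 0 = 0"
  by (simp add: signed_powr_def)

lemma signed_powr_minus [simp]: "signed_powr a (- t) = - signed_powr a t"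
  by (simp add: signed_powr_def)

lemma signed_powr_exponent_0 [simp]: "signed_powr 0 t = t"
  by (simp add: signed_powr_def)

lemma abs_signed_powr: "\<bar>signed_powr a t\<bar> = \<bar>t\<bar> powr (a + 1)"
  by (simp add: signed_powr_def abs_mult powr_add)

lemma signed_powr_nonneg: "0 \<le> t \<Longrightarrow> signed_powr a t = t powr (a + 1)"
  by (simp add: signed_powr_def powr_add)

lemma signed_powr_mono:
  assumes "0 \<le> a" "x \<le> y" shows "signed_powr a x \<le> signed_powr a y"
proof -
  consider "0 \<le> x" | "y \<le> 0" | "x < 0" "0 < y" by linarith
  then show ?thesis
  proof cases
    case 1
    then show ?thesis using assms by (simp add: signed_powr_nonneg powr_mono2)
  next
    case 2
    then have "signed_powr a (- y) \<le> signed_powr a (- x)"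
      using assms by (simp only: signed_powr_nonneg powr_mono2)
    then show ?thesis by simp
  next
    case 3
    then show ?thesis
      by (smt (verit) mult_nonneg_nonneg mult_nonneg_nonpos powr_ge_zero signed_powr_def)
  qed
qed

lemma continuous_signed_powr:
  assumes "0 \<le> a" shows "continuous_on UNIV (signed_powr a)"
proof (cases "a = 0")
  case True
  then have "signed_powr a = (\<lambda>t. t)" by (simp add: fun_eq_iff)
  then show ?thesis by simp
next
  case False
  with assms show ?thesis unfolding signed_powr_def
    by (intro continuous_intros continuous_on_powr') auto
qed

lemma borel_measurable_signed_powr [measurable]: "signed_powr a \<in> borel_measurable borel"
  unfolding signed_powr_def by measurable

text \<open>Young's inequality for \<open>a powr (p - 1)\<close> and \<open>b\<close>, with
  conjugate exponents \<open>p / (p - 1)\<close> and \<open>p\<close>.\<close>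

lemma powr_mult_le_powr_add:
  fixes p :: real
  assumes "1 < p" "0 \<le> a" "0 \<le> b"
  shows "a powr (p - 1) * b \<le> (p - 1) / p * a powr p + b powr p / p"
proof -
  have "1 / p + 1 / (p / (p - 1)) = 1" "p / (p - 1) > 1"
    using assms by (auto simp: field_simps)
  from Youngs_inequality[OF assms(1) this(2,1) assms(3), of "a powr (p - 1)"]
  moreover have "(p - 1) * (p / (p - 1)) = p" using assms by (simp add: field_simps)
  ultimately have "b * a powr (p - 1) \<le> b powr p / p + a powr p / (p / (p - 1))"
    by (simp only: powr_powr mult.commute[of b "a powr (p - 1)"] powr_ge_zero assms(3) simp_thms)
  then show ?thesis by (simp add: mult.commute add.commute)
qed

text \<open>A convex function lies above its tangent; since \<open>signed_powr (p - 2) a * a\<close>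
  is \<open>\<bar>a\<bar> powr p\<close>, this is Young's inequality rearranged. It supplies the
  subgradients of both \<Phi> and \<phi>.\<close>

lemma powr_tangent:
  fixes p :: real
  assumes "1 < p"
  shows "\<bar>a\<bar> powr p / p + signed_powr (p - 2) a * (b - a) \<le> \<bar>b\<bar> powr p / p"
proof -
  have "signed_powr (p - 2) a * b \<le> \<bar>signed_powr (p - 2) a\<bar> * \<bar>b\<bar>"
    by (metis abs_ge_self abs_mult)
  also have "\<dots> = \<bar>a\<bar> powr (p - 1) * \<bar>b\<bar>"
    by (simp add: abs_signed_powr)
  also have "\<dots> \<le> (p - 1) / p * \<bar>a\<bar> powr p + \<bar>b\<bar> powr p / p"
    using powr_mult_le_powr_add[OF assms, of "\<bar>a\<bar>" "\<bar>b\<bar>"] by simp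
  finally have 1: "signed_powr (p - 2) a * b \<le> (p - 1) / p * \<bar>a\<bar> powr p + \<bar>b\<bar> powr p / p" .
  have "\<bar>a\<bar> powr p = \<bar>a\<bar> powr ((p - 2) + 2)" by simp
  also have "\<dots> = \<bar>a\<bar> powr (p - 2) * \<bar>a\<bar> powr 2" by (rule powr_add)
  finally have "signed_powr (p - 2) a * a = \<bar>a\<bar> powr p"
    by (cases "a = 0") (simp_all add: signed_powr_def power2_eq_square)
  then have "signed_powr (p - 2) a * (b - a) = signed_powr (p - 2) a * b - \<bar>a\<bar> powr p"
    by (simp add: right_diff_distrib)
  moreover have "(p - 1) / p * \<bar>a\<bar> powr p = \<bar>a\<bar> powr p - \<bar>a\<bar> powr p / p"
    using assms by (simp add: diff_divide_distrib left_diff_distrib)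
  ultimately show ?thesis using 1 by linarith
qed

lemma powr_diff_le:
  fixes m :: real
  assumes "0 \<le> m" "0 \<le> b" "b \<le> a"
  shows "a powr (m + 1) - b powr (m + 1) \<le> (m + 1) * a powr m * (a - b)"
proof (cases "m = 0 \<or> a = 0")
  case True
  then show ?thesis using assms by auto
next
  case False
  have e: "signed_powr (m + 1 - 2) a = a powr m"
    using assms by (subst signed_powr_nonneg) auto
  have "\<bar>a\<bar> powr (m + 1) / (m + 1) + a powr m * (b - a) \<le> \<bar>b\<bar> powr (m + 1) / (m + 1)"
    using powr_tangent[of "m + 1" a b] False assms unfolding e by simp
  then have "(a powr (m + 1) - b powr (m + 1)) / (m + 1) \<le> a powr m * (a - b)"
    using assms by (simp add: diff_divide_distrib algebra_simps)
  then have "a powr (m + 1) - b powr (m + 1) \<le> a powr m * (a - b) * (m + 1)"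
    using assms by (simp only: pos_divide_le_eq)
  then show ?thesis by (simp add: ac_simps)
qed

text \<open>On \<open>[-a, a]\<close> the derivative of the odd power is at most its value
  \<open>(m + 1) * a powr m\<close> at \<open>a\<close>. For negative \<open>b\<close> the estimate
  \<open>\<bar>b\<bar> powr m \<le> a powr m\<close> takes the place of convexity.\<close>

lemma abs_signed_powr_diff_le:
  fixes m :: real
  assumes "0 \<le> m" "\<bar>b\<bar> \<le> a"
  shows "\<bar>signed_powr m a - signed_powr m b\<bar> \<le> (m + 1) * a powr m * (a - b)"
proof -
  have a: "0 \<le> a" "b \<le> a" using assms by auto
  have eq: "\<bar>signed_powr m a - signed_powr m b\<bar> = signed_powr m a - signed_powr m b"
    using signed_powr_mono[OF assms(1) a(2)] by simp
  show ?thesis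
  proof (cases "0 \<le> b")
    case True
    then show ?thesis
      unfolding eq using powr_diff_le[OF assms(1) True a(2)] a by (simp add: signed_powr_nonneg)
  next
    case False
    have "\<bar>b\<bar> powr m * \<bar>b\<bar> \<le> a powr m * \<bar>b\<bar>"
      using assms by (intro mult_right_mono powr_mono2) auto
    then have "signed_powr m a - signed_powr m b \<le> 1 * (a powr m * (a - b))"
      using False a by (simp add: signed_powr_def algebra_simps)
    also have "\<dots> \<le> (m + 1) * (a powr m * (a - b))"
      using a assms by (intro mult_right_mono) auto
    finally show ?thesis unfolding eq by (simp add: mult.assoc)
  qed
qed

text \<open>For \<open>b \<ge> 0\<close>, replacing \<open>b powr k\<close> by
  \<open>a powr k\<close> gives the bound even without the factor 2. For \<open>b < 0\<close> the
  odd power at \<open>b\<close> is nonpositive and \<open>a - b \<le> 2 * a\<close>, which costs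
  that factor.\<close>

lemma signed_powr_diff_ge:
  fixes k :: real
  assumes "0 \<le> k" "\<bar>b\<bar> \<le> a"
  shows "a powr k * (a - b) \<le> 2 * (signed_powr k a - signed_powr k b)"
proof (cases "0 \<le> b")
  case True
  have "b powr k * b \<le> a powr k * b"
    using assms True by (intro mult_right_mono powr_mono2) auto
  then have "a powr k * (a - b) \<le> signed_powr k a - signed_powr k b"
    using assms True by (simp add: signed_powr_def algebra_simps)
  moreover have "0 \<le> a powr k * (a - b)" using assms by simp
  moreover have "X \<le> 2 * Y" if "X \<le> Y" "0 \<le> X" for X Y :: real using that by linarith
  ultimately show ?thesis by blast
next
  case False
  have "a powr k * (a - b) \<le> a powr k * (2 * a)"
    using assms by (intro mult_left_mono) auto
  also have "\<dots> \<le> 2 * (signed_powr k a - signed_powr k b)"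
    using assms False by (auto simp: signed_powr_def mult_nonneg_nonpos)
  finally show ?thesis .
qed

text \<open>The 2 is the factor lost in \<open>signed_powr_diff_ge\<close>; the power comes from the
  factor \<open>m + 1\<close> of \<open>abs_signed_powr_diff_le\<close> with
  \<open>m = (r - 2) / p\<close>. This value, free of \<mu>, serves as \<beta>.\<close>

definition comparison_const :: "real \<Rightarrow> real \<Rightarrow> real" where
  "comparison_const p r = 1 / (2 * ((r - 2) / p + 1) powr p)"

lemma comparison_const_pos: "0 < p \<Longrightarrow> 2 \<le> r \<Longrightarrow> 0 < comparison_const p r"
  by (simp add: comparison_const_def add_nonneg_pos less_imp_neq[symmetric])

text \<open>For \<open>\<bar>b\<bar> \<le> a\<close> both sides are compared with
  \<open>a powr (r - 2) * (a - b) powr p\<close>. The exponents meet because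
  \<open>(r - 2) / p\<close> times \<open>p\<close> is \<open>r - 2\<close>.\<close>

lemma signed_powr_comparison:
  fixes p r :: real
  assumes "1 \<le> p" "2 \<le> r"
  shows "comparison_const p r * \<bar>signed_powr ((r - 2) / p) a - signed_powr ((r - 2) / p) b\<bar> powr p
           \<le> signed_powr (p - 2) (a - b) * (signed_powr (r - 2) a - signed_powr (r - 2) b)"
    (is "?L a b \<le> ?R a b")
proof -
  define m where "m = (r - 2) / p"
  have m: "0 \<le> m" "m * p = r - 2" using assms by (auto simp: m_def)
  have main: "?L a b \<le> ?R a b" if ab: "\<bar>b\<bar> \<le> a" for a b
  proof -
    have a: "0 \<le> a" "b \<le> a" using ab by auto
    have "\<bar>signed_powr m a - signed_powr m b\<bar> powr p \<le> ((m + 1) * a powr m * (a - b)) powr p"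
      using assms by (intro powr_mono2 abs_signed_powr_diff_le m ab) auto
    also have "\<dots> = (m + 1) powr p * (a powr (r - 2) * (a - b) powr p)"
      using m a by (simp add: powr_mult powr_powr)
    finally have "?L a b \<le> comparison_const p r * ((m + 1) powr p * (a powr (r - 2) * (a - b) powr p))"
      unfolding m_def by (rule mult_left_mono) (use assms comparison_const_pos[of p r] in auto)
    also have "\<dots> = a powr (r - 2) * (a - b) powr p / 2"
      using m by (simp add: comparison_const_def m_def[symmetric])
    also have "\<dots> = (a - b) powr (p - 1) * (a powr (r - 2) * (a - b)) / 2"
      using a powr_add[of "a - b" "p - 1" 1] by simp
    also have "\<dots> \<le> (a - b) powr (p - 1) * (2 * (signed_powr (r - 2) a - signed_powr (r - 2) b)) / 2"
      using assms by (intro divide_right_mono mult_left_mono signed_powr_diff_ge ab) auto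
    also have "\<dots> = ?R a b"
      using a by (simp add: signed_powr_nonneg)
    finally show ?thesis .
  qed
  \<comment> \<open>Both sides are invariant under swapping the arguments and under negating both,
    so the argument of larger modulus can be moved to the first place and made nonnegative.\<close>
  have sym: "?L (- a) (- b) = ?L a b" "?R (- a) (- b) = ?R a b" "?L b a = ?L a b" "?R b a = ?R a b" for a b
  proof -
    have 1: "- a - - b = - (a - b)" "b - a = - (a - b)" for a b :: real by auto
    show "?R (- a) (- b) = ?R a b" unfolding 1(1) signed_powr_minus by (simp add: algebra_simps)
    show "?R b a = ?R a b" unfolding 1(2)[of b a] signed_powr_minus by (simp add: algebra_simps)
    show "?L (- a) (- b) = ?L a b" "?L b a = ?L a b" by (simp_all add: abs_minus_commute)
  qed
  consider "\<bar>b\<bar> \<le> a" | "\<bar>b\<bar> \<le> - a" | "\<bar>a\<bar> \<le> b" | "\<bar>a\<bar> \<le> - b" by linarith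
  then show ?thesis
  proof cases
    case 2
    then show ?thesis using main[where a = "- a" and b = "- b"]
      unfolding sym(1)[where a = a and b = b] sym(2)[where a = a and b = b] by simp
  next
    case 4
    then show ?thesis using main[where a = "- b" and b = "- a"]
      unfolding sym(1)[where a = b and b = a] sym(2)[where a = b and b = a]
        sym(3)[where a = a and b = b] sym(4)[where a = a and b = b] by simp
  next
    case 3
    then show ?thesis using main[where a = b and b = a]
      unfolding sym(3)[where a = a and b = b] sym(4)[where a = a and b = b] by simp
  qed (rule main)
qed

text \<open>The pointwise resolvent: \<open>J\<^sub>\<mu>\<^sup>\<phi> u = shrink r \<mu> \<circ> u\<close> almost everywhere.\<close>

definition shrink :: "real \<Rightarrow> real \<Rightarrow> real \<Rightarrow> real" where
  "shrink r \<mu> = inv (\<lambda>t. t + \<mu> * signed_powr (r - 2) t)"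

lemma shrink_eq:
  assumes "2 \<le> r" "0 < \<mu>"
  shows "shrink r \<mu> t + \<mu> * signed_powr (r - 2) (shrink r \<mu> t) = t"
proof -
  let ?h = "\<lambda>t. t + \<mu> * signed_powr (r - 2) t"
  have cont: "continuous_on A ?h" for A
    using assms continuous_on_subset[OF continuous_signed_powr[of "r - 2"]] by (auto intro!: continuous_intros)
  have pos: "0 \<le> signed_powr (r - 2) \<bar>t\<bar>" for t by (simp add: signed_powr_def)
  \<comment> \<open>The map pushes points away from 0, so its values at
    \<open>- \<bar>t\<bar>\<close> and \<open>\<bar>t\<bar>\<close> bracket \<open>t\<close>.
    Surjectivity makes \<open>inv\<close> a right inverse.\<close>
  have "\<exists>y. t = ?h y" for t
  proof -
    have "- \<bar>t\<bar> + \<mu> * signed_powr (r - 2) (- \<bar>t\<bar>) \<le> t" "t \<le> \<bar>t\<bar> + \<mu> * signed_powr (r - 2) \<bar>t\<bar>"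
      using mult_nonneg_nonneg[OF less_imp_le[OF assms(2)] pos[of t]] unfolding signed_powr_minus by linarith+
    then show ?thesis using IVT'[of ?h "- \<bar>t\<bar>" t "\<bar>t\<bar>"] cont by force
  qed
  then have "surj ?h" by (simp add: surj_def)
  then show ?thesis unfolding shrink_def by (rule surj_f_inv_f)
qed

text \<open>Both summands of \<open>t + \<mu> * signed_powr (r - 2) t\<close> are nondecreasing, so
  their increments share a sign and the absolute values add up. Dropping one summand or the other
  yields the next two Lipschitz bounds.\<close>

lemma shrink_diff:
  assumes "2 \<le> r" "0 < \<mu>"
  shows "\<bar>x - y\<bar> = \<bar>shrink r \<mu> x - shrink r \<mu> y\<bar> +
    \<mu> * \<bar>signed_powr (r - 2) (shrink r \<mu> x) - signed_powr (r - 2) (shrink r \<mu> y)\<bar>"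
proof -
  have *: "\<bar>x - y\<bar> = \<bar>X - Y\<bar> + \<mu> * \<bar>signed_powr (r - 2) X - signed_powr (r - 2) Y\<bar>"
    if "X + \<mu> * signed_powr (r - 2) X = x" "Y + \<mu> * signed_powr (r - 2) Y = y" "X \<le> Y" for X Y x y
  proof -
    have "signed_powr (r - 2) X \<le> signed_powr (r - 2) Y"
      using assms that by (intro signed_powr_mono) auto
    moreover from this have "\<mu> * signed_powr (r - 2) X \<le> \<mu> * signed_powr (r - 2) Y"
      using assms by simp
    ultimately show ?thesis using that by (simp add: right_diff_distrib)
  qed
  show ?thesis
  proof (cases "shrink r \<mu> x \<le> shrink r \<mu> y")
    case True
    then show ?thesis using * shrink_eq[OF assms] by blast
  next
    case False
    then have "shrink r \<mu> y \<le> shrink r \<mu> x" by simp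
    from *[OF shrink_eq[OF assms] shrink_eq[OF assms] this] show ?thesis
      by (simp add: abs_minus_commute)
  qed
qed

lemma shrink_lipschitz:
  assumes "2 \<le> r" "0 < \<mu>"
  shows "\<bar>shrink r \<mu> x - shrink r \<mu> y\<bar> \<le> \<bar>x - y\<bar>"
  using shrink_diff[OF assms, of x y] assms by (simp add: mult_nonneg_nonneg)

lemma signed_powr_shrink_lipschitz:
  assumes "2 \<le> r" "0 < \<mu>"
  shows "\<bar>signed_powr (r - 2) (shrink r \<mu> x) - signed_powr (r - 2) (shrink r \<mu> y)\<bar> \<le> 1 / \<mu> * \<bar>x - y\<bar>"
  using shrink_diff[OF assms, of x y] assms by (simp add: field_simps)

lemma shrink_0 [simp]:
  assumes "2 \<le> r" "0 < \<mu>" shows "shrink r \<mu> 0 = 0"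
proof -
  have s: "shrink r \<mu> 0 * signed_powr (r - 2) (shrink r \<mu> 0) \<ge> 0"
  proof -
    have "t * signed_powr (r - 2) t = \<bar>t\<bar> powr (r - 2) * t\<^sup>2" for t
      by (simp add: signed_powr_def power2_eq_square)
    then show ?thesis by simp
  qed
  have "shrink r \<mu> 0 = - (\<mu> * signed_powr (r - 2) (shrink r \<mu> 0))"
    using shrink_eq[OF assms, of 0] by linarith
  then have "shrink r \<mu> 0 * shrink r \<mu> 0 = - (\<mu> * (shrink r \<mu> 0 * signed_powr (r - 2) (shrink r \<mu> 0)))"
    by (metis mult.left_commute mult_minus_right)
  then have "shrink r \<mu> 0 * shrink r \<mu> 0 \<le> 0" using s assms by simp
  then show ?thesis by (metis mult_eq_0_iff not_square_less_zero order_antisym_conv linorder_not_less)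
qed

lemma abs_shrink_le:
  assumes "2 \<le> r" "0 < \<mu>" shows "\<bar>shrink r \<mu> x\<bar> \<le> \<bar>x\<bar>"
  using shrink_lipschitz[OF assms, of x 0] assms by simp

lemma borel_measurable_shrink [measurable]:
  assumes "2 \<le> r" "0 < \<mu>" shows "shrink r \<mu> \<in> borel_measurable borel"
proof (rule borel_measurable_continuous_onI)
  show "continuous_on UNIV (shrink r \<mu>)"
    using shrink_lipschitz[OF assms]
    by (auto simp: continuous_on_iff dist_real_def intro: le_less_trans)
qed

text \<open>With \<open>a\<close>, \<open>b\<close> the resolvent values at \<open>x\<close>,
  \<open>y\<close>, \<mu> times the difference of their odd powers is
  \<open>(x - y) - (a - b)\<close>. The comparison inequality thus chains with the tangent
  inequality based at \<open>a - b\<close> and evaluated at \<open>x - y\<close>.\<close>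

lemma resolvent_power_shrink_diff:
  assumes "1 < p" "2 \<le> r" "0 < \<mu>"
  defines "F \<equiv> \<lambda>t. signed_powr ((r - 2) / p) (shrink r \<mu> t)"
  shows "\<mu> * comparison_const p r * \<bar>F x - F y\<bar> powr p
           \<le> \<bar>x - y\<bar> powr p / p - \<bar>shrink r \<mu> x - shrink r \<mu> y\<bar> powr p / p"
proof -
  let ?a = "shrink r \<mu> x" and ?b = "shrink r \<mu> y"
  have "comparison_const p r * \<bar>F x - F y\<bar> powr p
      \<le> signed_powr (p - 2) (?a - ?b) * (signed_powr (r - 2) ?a - signed_powr (r - 2) ?b)"
    unfolding F_def using assms by (intro signed_powr_comparison) auto
  then have "\<mu> * (comparison_const p r * \<bar>F x - F y\<bar> powr p)
      \<le> \<mu> * (signed_powr (p - 2) (?a - ?b) * (signed_powr (r - 2) ?a - signed_powr (r - 2) ?b))"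
    using assms by simp
  also have "\<dots> = signed_powr (p - 2) (?a - ?b) * (\<mu> * signed_powr (r - 2) ?a - \<mu> * signed_powr (r - 2) ?b)"
    by (simp add: algebra_simps)
  also have "\<dots> = signed_powr (p - 2) (?a - ?b) * ((x - y) - (?a - ?b))"
    using shrink_eq[OF assms(2,3), of x] shrink_eq[OF assms(2,3), of y]
    by (intro arg_cong2[where f = "(*)"]) auto
  also have "\<dots> \<le> \<bar>x - y\<bar> powr p / p - \<bar>?a - ?b\<bar> powr p / p"
    using powr_tangent[OF assms(1), of "?a - ?b" "x - y"] by simp
  finally show ?thesis by (simp add: mult.assoc)
qed

text \<open>For \<open>r > 2\<close> the odd power alone is not globally Lipschitz, but its
  composition with \<open>shrink\<close> is: discard the subtracted term of the preceding estimate
  and take \<open>p\<close>-th roots. The constant may depend on \<mu>, since it only serves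
  membership.\<close>

lemma resolvent_power_shrink_lipschitz:
  assumes "1 < p" "2 \<le> r" "0 < \<mu>"
  obtains c where "0 \<le> c"
    "\<And>x y. \<bar>signed_powr ((r - 2) / p) (shrink r \<mu> x) - signed_powr ((r - 2) / p) (shrink r \<mu> y)\<bar> \<le> c * \<bar>x - y\<bar>"
proof
  define k where "k = p * (\<mu> * comparison_const p r)"
  have k: "0 < k" using assms comparison_const_pos[of p r] by (simp add: k_def)
  show "0 \<le> (1 / k) powr (1 / p)" by simp
  fix x y
  let ?d = "\<bar>signed_powr ((r - 2) / p) (shrink r \<mu> x) - signed_powr ((r - 2) / p) (shrink r \<mu> y)\<bar>"
  have "\<mu> * comparison_const p r * ?d powr p \<le> \<bar>x - y\<bar> powr p / p"
    using resolvent_power_shrink_diff[OF assms, of x y] assms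
    by (smt (verit) divide_nonneg_pos powr_ge_zero)
  then have "?d powr p \<le> 1 / k * \<bar>x - y\<bar> powr p"
    using k assms by (simp add: k_def field_simps)
  then have "(?d powr p) powr (1 / p) \<le> (1 / k * \<bar>x - y\<bar> powr p) powr (1 / p)"
    using assms by (intro powr_mono2) auto
  then show "?d \<le> (1 / k) powr (1 / p) * \<bar>x - y\<bar>"
    using assms k by (simp only: powr_mult powr_powr) (simp add: powr_mult powr_powr)
qed

subsection \<open>Resolvent and Moreau--Yosida approximation in \<open>L\<^sup>2\<close>\<close>

text \<open>Young's inequality, with both coefficients enlarged to 1, dominates the product
  pointwise by an integrable function.\<close>

lemma integrable_signed_powr_mult:
  fixes f h :: "'b \<Rightarrow> real"
  assumes p: "1 < p" and [measurable]: "f \<in> borel_measurable M" "h \<in> borel_measurable M"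
    and f: "integrable M (\<lambda>x. \<bar>f x\<bar> powr p)" and h: "integrable M (\<lambda>x. \<bar>h x\<bar> powr p)"
  shows "integrable M (\<lambda>x. signed_powr (p - 2) (f x) * h x)"
    and "\<bar>LINT x|M. signed_powr (p - 2) (f x) * h x\<bar>
      \<le> (LINT x|M. \<bar>f x\<bar> powr p) + (LINT x|M. \<bar>h x\<bar> powr p)"
proof -
  have le: "\<bar>signed_powr (p - 2) (f x) * h x\<bar> \<le> \<bar>f x\<bar> powr p + \<bar>h x\<bar> powr p" for x
  proof -
    have "\<bar>signed_powr (p - 2) (f x) * h x\<bar> = \<bar>f x\<bar> powr (p - 1) * \<bar>h x\<bar>"
      by (simp add: abs_mult abs_signed_powr)
    also have "\<dots> \<le> (p - 1) / p * \<bar>f x\<bar> powr p + \<bar>h x\<bar> powr p / p"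
      using p by (intro powr_mult_le_powr_add) auto
    also have "\<dots> \<le> 1 * \<bar>f x\<bar> powr p + \<bar>h x\<bar> powr p / 1"
      using p by (intro add_mono mult_right_mono divide_left_mono) auto
    finally show ?thesis by simp
  qed
  show int: "integrable M (\<lambda>x. signed_powr (p - 2) (f x) * h x)"
    by (rule Bochner_Integration.integrable_bound[OF Bochner_Integration.integrable_add[OF f h]])
       (use le in \<open>auto simp: order_trans[OF _ abs_ge_self]\<close>)
  have "\<bar>LINT x|M. signed_powr (p - 2) (f x) * h x\<bar> \<le> (LINT x|M. \<bar>signed_powr (p - 2) (f x) * h x\<bar>)"
    by (rule integral_abs_bound)
  also have "\<dots> \<le> (LINT x|M. \<bar>f x\<bar> powr p + \<bar>h x\<bar> powr p)"
    using int f h le by (intro integral_mono) auto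
  also have "\<dots> = (LINT x|M. \<bar>f x\<bar> powr p) + (LINT x|M. \<bar>h x\<bar> powr p)"
    using f h by simp
  finally show "\<bar>LINT x|M. signed_powr (p - 2) (f x) * h x\<bar>
      \<le> (LINT x|M. \<bar>f x\<bar> powr p) + (LINT x|M. \<bar>h x\<bar> powr p)" .
qed

text \<open>A Hoelder inequality with a non-sharp constant: membership in a dual space only asks for
  boundedness in \<open>h\<close>.\<close>

lemma integral_signed_powr_mult_le_norm:
  fixes f h :: "'b \<Rightarrow> real"
  assumes p: "1 < p" and meas [measurable]: "f \<in> borel_measurable M" "h \<in> borel_measurable M"
    and f: "integrable M (\<lambda>x. \<bar>f x\<bar> powr p)" and h: "integrable M (\<lambda>x. \<bar>h x\<bar> powr p)"
  shows "\<bar>LINT x|M. signed_powr (p - 2) (f x) * h x\<bar>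
      \<le> ((LINT x|M. \<bar>f x\<bar> powr p) + 1) * (LINT x|M. \<bar>h x\<bar> powr p) powr (1 / p)"
proof (cases "(LINT x|M. \<bar>h x\<bar> powr p) = 0")
  case True
  then have "AE x in M. \<bar>h x\<bar> powr p = 0"
    using h by (subst (asm) integral_nonneg_eq_0_iff_AE) auto
  then have "AE x in M. signed_powr (p - 2) (f x) * h x = 0" by auto
  then have "(LINT x|M. signed_powr (p - 2) (f x) * h x) = 0"
    by (rule integral_eq_zero_AE)
  then show ?thesis using True by simp
next
  case False
  \<comment> \<open>Scaling \<open>h\<close> to unit norm turns the additive bound into a multiplicative one.\<close>
  define B where "B = (LINT x|M. \<bar>h x\<bar> powr p)"
  define I where "I = (LINT x|M. signed_powr (p - 2) (f x) * h x)"
  define c where "c = B powr (- (1 / p))"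
  have B: "0 < B" using False by (simp add: B_def less_le)
  then have c: "0 < c" by (simp add: c_def)
  have cp: "c powr p * B = 1"
    using B p by (simp only: c_def powr_powr) (simp add: powr_minus)
  have "integrable M (\<lambda>x. \<bar>c * h x\<bar> powr p)"
    using h c by (simp add: abs_mult powr_mult)
  from integrable_signed_powr_mult(2)[OF p _ _ f this]
  have "\<bar>LINT x|M. signed_powr (p - 2) (f x) * (c * h x)\<bar>
      \<le> (LINT x|M. \<bar>f x\<bar> powr p) + (LINT x|M. \<bar>c * h x\<bar> powr p)" by simp
  moreover have "(LINT x|M. signed_powr (p - 2) (f x) * (c * h x)) = c * I"
    unfolding I_def by (subst integral_mult_right_zero[symmetric]) (simp add: ac_simps)
  moreover have "(LINT x|M. \<bar>c * h x\<bar> powr p) = 1"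
    using c cp by (simp add: abs_mult powr_mult B_def)
  ultimately have "c * \<bar>I\<bar> \<le> (LINT x|M. \<bar>f x\<bar> powr p) + 1"
    using c by (simp add: abs_mult)
  then have "B powr (1 / p) * (c * \<bar>I\<bar>) \<le> B powr (1 / p) * ((LINT x|M. \<bar>f x\<bar> powr p) + 1)"
    by (intro mult_left_mono) auto
  moreover have "B powr (1 / p) * c = 1"
    using B by (simp add: c_def powr_minus)
  ultimately show ?thesis by (simp add: I_def B_def mult.assoc[symmetric] mult.commute)
qed

section \<open>Lebesgue spaces on \<Omega> through extension by zero\<close>

lemma set_integral_eq_integral_of_AE_zero:
  fixes f :: "'a::euclidean_space \<Rightarrow> real"
  assumes [measurable]: "\<Omega> \<in> sets borel" "f \<in> borel_measurable borel"
    and z: "AE x in lborel. x \<notin> \<Omega> \<longrightarrow> f x = 0"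
  shows "(LINT x:\<Omega>|lborel. f x) = (LINT x|lborel. f x)"
    and "set_integrable lborel \<Omega> f \<longleftrightarrow> integrable lborel f"
proof -
  have "AE x in lborel. indicator \<Omega> x *\<^sub>R f x = f x"
    using z by eventually_elim (auto simp: indicator_def)
  then show "(LINT x:\<Omega>|lborel. f x) = (LINT x|lborel. f x)"
    "set_integrable lborel \<Omega> f \<longleftrightarrow> integrable lborel f"
    unfolding set_lebesgue_integral_def set_integrable_def
    by (intro integral_cong_AE integrable_cong_AE; simp)+
qed

lemma Lebesgue_space_measurable [measurable_dest]:
  "u \<in> Lebesgue_space \<Omega> q \<Longrightarrow> u \<in> borel_measurable borel"
  by (simp add: Lebesgue_space_def)

lemma Lebesgue_space_iff:
  assumes "\<Omega> \<in> sets borel"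
  shows "u \<in> Lebesgue_space \<Omega> q \<longleftrightarrow> u \<in> borel_measurable borel \<and>
    (AE x in lborel. x \<notin> \<Omega> \<longrightarrow> u x = 0) \<and> integrable lborel (\<lambda>x. \<bar>u x\<bar> powr q)"
proof -
  have "set_integrable lborel \<Omega> (\<lambda>x. \<bar>u x\<bar> powr q) \<longleftrightarrow> integrable lborel (\<lambda>x. \<bar>u x\<bar> powr q)"
    if "u \<in> borel_measurable borel" "AE x in lborel. x \<notin> \<Omega> \<longrightarrow> u x = 0"
    using assms that by (intro set_integral_eq_integral_of_AE_zero(2)) auto
  then show ?thesis by (auto simp: Lebesgue_space_def)
qed

lemma Lebesgue_space_set_integral:
  assumes "\<Omega> \<in> sets borel" "u \<in> Lebesgue_space \<Omega> q"
  shows "(LINT x:\<Omega>|lborel. \<bar>u x\<bar> powr q) = (LINT x|lborel. \<bar>u x\<bar> powr q)"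
  using assms by (intro set_integral_eq_integral_of_AE_zero(1)) (auto simp: Lebesgue_space_iff)

lemma Lebesgue_space_dominated:
  assumes "\<Omega> \<in> sets borel" "0 \<le> q" and u: "u \<in> Lebesgue_space \<Omega> q"
    and [measurable]: "f \<in> borel_measurable borel"
    and c: "0 \<le> c" and le: "AE x in lborel. \<bar>f x\<bar> \<le> c * \<bar>u x\<bar>"
  shows "f \<in> Lebesgue_space \<Omega> q"
proof -
  note [measurable] = Lebesgue_space_measurable[OF u]
  have u': "AE x in lborel. x \<notin> \<Omega> \<longrightarrow> u x = 0" "integrable lborel (\<lambda>x. \<bar>u x\<bar> powr q)"
    using u assms(1) by (auto simp: Lebesgue_space_iff)
  have "integrable lborel (\<lambda>x. \<bar>f x\<bar> powr q)"
  proof (rule Bochner_Integration.integrable_bound)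
    show "integrable lborel (\<lambda>x. c powr q * \<bar>u x\<bar> powr q)" using u'(2) by simp
    show "AE x in lborel. norm (\<bar>f x\<bar> powr q) \<le> norm (c powr q * \<bar>u x\<bar> powr q)"
      using le
    proof eventually_elim
      case (elim x)
      then have "\<bar>f x\<bar> powr q \<le> (c * \<bar>u x\<bar>) powr q" using assms by (intro powr_mono2) auto
      then show ?case using c by (simp add: powr_mult)
    qed
  qed auto
  moreover have "AE x in lborel. x \<notin> \<Omega> \<longrightarrow> f x = 0"
    using u'(1) le by eventually_elim auto
  ultimately show ?thesis using assms(1) by (simp add: Lebesgue_space_iff)
qed

text \<open>On \<Omega> the lower power is at most \<open>1 + \<bar>u x\<bar> powr q\<close>, and
  the constant is integrable there because a bounded set has finite measure. With
  \<open>q' = 2\<close> this places \<open>V\<close> inside \<open>H\<close>.\<close>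

lemma Lebesgue_space_bounded_mono:
  assumes \<Omega>: "\<Omega> \<in> sets borel" "bounded \<Omega>" and q: "0 \<le> q'" "q' \<le> q"
    and u: "u \<in> Lebesgue_space \<Omega> q"
  shows "u \<in> Lebesgue_space \<Omega> q'"
proof -
  note [measurable] = Lebesgue_space_measurable[OF u]
  have u': "AE x in lborel. x \<notin> \<Omega> \<longrightarrow> u x = 0" "integrable lborel (\<lambda>x. \<bar>u x\<bar> powr q)"
    using u \<Omega>(1) by (auto simp: Lebesgue_space_iff)
  have "integrable lborel (indicator \<Omega> :: 'a \<Rightarrow> real)"
    using \<Omega> emeasure_bounded_finite[OF \<Omega>(2)] by (simp add: integrable_indicator_iff)
  then have "integrable lborel (\<lambda>x. indicator \<Omega> x + \<bar>u x\<bar> powr q)"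
    using u' by simp
  moreover have "(\<lambda>x. \<bar>u x\<bar> powr q') \<in> borel_measurable lborel" by measurable
  moreover have "AE x in lborel. norm (\<bar>u x\<bar> powr q') \<le> norm (indicator \<Omega> x + \<bar>u x\<bar> powr q)"
    using u'(1)
  proof eventually_elim
    case (elim x)
    show ?case
    proof (cases "x \<in> \<Omega>")
      case True
      have "\<bar>u x\<bar> powr q' \<le> 1 + \<bar>u x\<bar> powr q"
      proof (cases "\<bar>u x\<bar> \<le> 1")
        case True
        then have "\<bar>u x\<bar> powr q' \<le> 1" using q powr_mono2[of q' "\<bar>u x\<bar>" 1] by simp
        then show ?thesis by (simp add: add_increasing2)
      next
        case False
        then show ?thesis using q by (simp add: add_increasing powr_mono)
      qed
      then show ?thesis using True by simp
    qed (use elim in simp)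
  qed
  ultimately have "integrable lborel (\<lambda>x. \<bar>u x\<bar> powr q')"
    by (rule Bochner_Integration.integrable_bound)
  then show ?thesis using u' \<Omega>(1) by (simp add: Lebesgue_space_iff)
qed

lemma H_space_integrable_mult:
  assumes "\<Omega> \<in> sets borel" "f \<in> H_space \<Omega>" "h \<in> H_space \<Omega>"
  shows "integrable lborel (\<lambda>x. f x * h x)"
  using integrable_signed_powr_mult(1)[of 2 f lborel h] assms by (simp add: Lebesgue_space_iff)

lemma H_space_lincomb:
  assumes \<Omega>: "\<Omega> \<in> sets borel" and f: "f \<in> H_space \<Omega>" and h: "h \<in> H_space \<Omega>"
  shows "(\<lambda>x. c * f x + d * h x) \<in> H_space \<Omega>"
proof -
  note [measurable] = Lebesgue_space_measurable[OF f] Lebesgue_space_measurable[OF h]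
  have "integrable lborel (\<lambda>x. c\<^sup>2 * (f x * f x) + 2 * c * d * (f x * h x) + d\<^sup>2 * (h x * h x))"
    using H_space_integrable_mult[OF \<Omega>] f h by simp
  then have "integrable lborel (\<lambda>x. \<bar>c * f x + d * h x\<bar> powr 2)"
    by (simp add: power2_eq_square algebra_simps)
  moreover have "AE x in lborel. x \<notin> \<Omega> \<longrightarrow> f x = 0" "AE x in lborel. x \<notin> \<Omega> \<longrightarrow> h x = 0"
    using f h \<Omega> by (auto simp: Lebesgue_space_iff)
  then have "AE x in lborel. x \<notin> \<Omega> \<longrightarrow> c * f x + d * h x = 0"
    by eventually_elim auto
  ultimately show ?thesis using \<Omega> by (simp add: Lebesgue_space_iff)
qed

lemma H_space_diff:
  assumes "\<Omega> \<in> sets borel" "f \<in> H_space \<Omega>" "h \<in> H_space \<Omega>"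
  shows "(\<lambda>x. f x - h x) \<in> H_space \<Omega>"
  using H_space_lincomb[OF assms, of 1 "- 1"] by simp

lemma H_inner_eq:
  assumes "\<Omega> \<in> sets borel" "f \<in> H_space \<Omega>" "h \<in> H_space \<Omega>"
  shows "(LINT x:\<Omega>|lborel. f x * h x) = (LINT x|lborel. f x * h x)"
proof (rule set_integral_eq_integral_of_AE_zero(1))
  show "AE x in lborel. x \<notin> \<Omega> \<longrightarrow> f x * h x = 0"
    using assms by (auto simp: Lebesgue_space_iff)
qed (use assms in auto)

lemma H_norm_power2:
  assumes "\<Omega> \<in> sets borel" "f \<in> H_space \<Omega>"
  shows "(H_norm \<Omega> f)\<^sup>2 = (LINT x|lborel. f x * f x)"
proof -
  have "0 \<le> (LINT x|lborel. f x * f x)" by simp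
  then show ?thesis
    using Lebesgue_space_set_integral[OF assms]
    by (simp add: Lebesgue_norm_def powr_half_sqrt power2_eq_square)
qed

section \<open>Subdifferentials in \<open>H\<close> and uniqueness of the resolvent\<close>

lemma H_inner_in_dual_space:
  assumes \<Omega>: "\<Omega> \<in> sets borel" and w: "w \<in> H_space \<Omega>"
  shows "(\<lambda>h. LINT x:\<Omega>|lborel. w x * h x) \<in> dual_space (H_space \<Omega>) (H_norm \<Omega>)"
proof -
  note [measurable] = Lebesgue_space_measurable[OF w]
  have int: "set_integrable lborel \<Omega> (\<lambda>x. w x * h x)" if "h \<in> H_space \<Omega>" for h
  proof (subst set_integral_eq_integral_of_AE_zero(2)[OF \<Omega>])
    show "AE x in lborel. x \<notin> \<Omega> \<longrightarrow> w x * h x = 0"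
      using w \<Omega> by (auto simp: Lebesgue_space_iff)
  qed (use H_space_integrable_mult[OF \<Omega> w that] that in auto)
  have "\<bar>LINT x:\<Omega>|lborel. w x * h x\<bar> \<le> ((LINT x|lborel. \<bar>w x\<bar> powr 2) + 1) * H_norm \<Omega> h"
    if h: "h \<in> H_space \<Omega>" for h
    unfolding H_inner_eq[OF \<Omega> w h] Lebesgue_norm_def Lebesgue_space_set_integral[OF \<Omega> h]
    using integral_signed_powr_mult_le_norm[of 2 w lborel h] w h \<Omega>
    by (simp add: Lebesgue_space_iff)
  then show ?thesis unfolding dual_space_def
    using int by (auto simp: distrib_left mult.left_commute[of _ c for c])
qed

text \<open>Every \<open>w\<close> in \<open>H\<close> acts boundedly through the inner product, so
  only the subgradient inequality remains, with its integral extended to the whole space.\<close>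

lemma subdiff_H_iff:
  assumes \<Omega>: "\<Omega> \<in> sets borel" and u: "u \<in> H_space \<Omega>"
  shows "w \<in> subdiff_H \<Omega> \<phi> u \<longleftrightarrow> w \<in> H_space \<Omega> \<and> \<phi> u \<noteq> \<infinity> \<and>
    (\<forall>h\<in>H_space \<Omega>. ereal (LINT x|lborel. w x * (h x - u x)) \<le> \<phi> h - \<phi> u)"
proof -
  have "(LINT x:\<Omega>|lborel. w x * (h x - u x)) = (LINT x|lborel. w x * (h x - u x))"
    if "w \<in> H_space \<Omega>" "h \<in> H_space \<Omega>" for h
    using H_inner_eq[OF \<Omega> that(1) H_space_diff[OF \<Omega> that(2) u]] .
  then show ?thesis
    using H_inner_in_dual_space[OF \<Omega>] by (auto simp: subdiff_H_def subdiff_def)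
qed

text \<open>The subgradient inequalities at \<open>v\<close> and \<open>v'\<close>, each tested with
  the other point, are added. Since both values are finite, they cancel in the sum.\<close>

lemma subdiff_H_mono:
  assumes \<Omega>: "\<Omega> \<in> sets borel" and v: "v \<in> H_space \<Omega>" "v' \<in> H_space \<Omega>"
    and \<phi>: "\<phi> v \<noteq> -\<infinity>" "\<phi> v' \<noteq> -\<infinity>"
    and \<xi>: "\<xi> \<in> subdiff_H \<Omega> \<phi> v" "\<xi>' \<in> subdiff_H \<Omega> \<phi> v'"
  shows "0 \<le> (LINT x|lborel. (\<xi> x - \<xi>' x) * (v x - v' x))"
proof -
  have \<xi>H: "\<xi> \<in> H_space \<Omega>" "\<xi>' \<in> H_space \<Omega>"
    and fin: "\<phi> v \<noteq> \<infinity>" "\<phi> v' \<noteq> \<infinity>"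
    and le: "ereal (LINT x|lborel. \<xi> x * (v' x - v x)) \<le> \<phi> v' - \<phi> v"
      "ereal (LINT x|lborel. \<xi>' x * (v x - v' x)) \<le> \<phi> v - \<phi> v'"
    using \<xi> v by (simp_all add: subdiff_H_iff[OF \<Omega>])
  obtain a b where "\<phi> v = ereal a" "\<phi> v' = ereal b" using \<phi> fin by (metis ereal_cases)
  with le have "(LINT x|lborel. \<xi> x * (v' x - v x)) + (LINT x|lborel. \<xi>' x * (v x - v' x)) \<le> 0"
    by simp
  also have "(LINT x|lborel. \<xi> x * (v' x - v x)) + (LINT x|lborel. \<xi>' x * (v x - v' x))
      = (LINT x|lborel. \<xi> x * (v' x - v x) + \<xi>' x * (v x - v' x))"
    using H_space_integrable_mult[OF \<Omega>] H_space_diff[OF \<Omega>] \<xi>H v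
    by (intro Bochner_Integration.integral_add[symmetric]) auto
  also have "\<dots> = (LINT x|lborel. - ((\<xi> x - \<xi>' x) * (v x - v' x)))"
    by (intro Bochner_Integration.integral_cong) (auto simp: algebra_simps)
  finally show ?thesis by simp
qed

text \<open>Two solutions satisfy \<open>\<mu> * (\<xi> x - \<xi>' x) = - (v x - v' x)\<close>.
  Multiplying by \<open>v x - v' x\<close> and integrating, monotonicity makes the squared
  \<open>L^2\<close> distance nonpositive.\<close>

lemma resolvent_unique_AE:
  assumes \<Omega>: "\<Omega> \<in> sets borel" and \<mu>: "0 < \<mu>"
    and v: "v \<in> H_space \<Omega>" "v' \<in> H_space \<Omega>"
    and \<phi>: "\<phi> v \<noteq> -\<infinity>" "\<phi> v' \<noteq> -\<infinity>"
    and \<xi>: "\<xi> \<in> subdiff_H \<Omega> \<phi> v" "\<xi>' \<in> subdiff_H \<Omega> \<phi> v'"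
    and u: "AE x in lborel. u x = v x + \<mu> * \<xi> x" "AE x in lborel. u x = v' x + \<mu> * \<xi>' x"
  shows "AE x in lborel. v x = v' x"
proof -
  note [measurable] = Lebesgue_space_measurable[OF v(1)] Lebesgue_space_measurable[OF v(2)]
  have \<xi>H: "\<xi> \<in> H_space \<Omega>" "\<xi>' \<in> H_space \<Omega>"
    using \<xi> v by (simp_all add: subdiff_H_iff[OF \<Omega>])
  note [measurable] = Lebesgue_space_measurable[OF \<xi>H(1)] Lebesgue_space_measurable[OF \<xi>H(2)]
  have "AE x in lborel. \<mu> * ((\<xi> x - \<xi>' x) * (v x - v' x)) = - ((v x - v' x) * (v x - v' x))"
    using u
  proof eventually_elim
    case (elim x)
    then have "\<mu> * (\<xi> x - \<xi>' x) = - (v x - v' x)" by (simp add: right_diff_distrib)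
    then show ?case by (metis mult.assoc mult_minus_left)
  qed
  then have "(LINT x|lborel. \<mu> * ((\<xi> x - \<xi>' x) * (v x - v' x))) =
      (LINT x|lborel. - ((v x - v' x) * (v x - v' x)))"
    by (intro integral_cong_AE) auto
  then have "(LINT x|lborel. (v x - v' x) * (v x - v' x)) = - (\<mu> * (LINT x|lborel. (\<xi> x - \<xi>' x) * (v x - v' x)))"
    by simp
  also have "\<dots> \<le> 0"
    using subdiff_H_mono[OF \<Omega> v \<phi> \<xi>] \<mu> by simp
  finally have "(LINT x|lborel. (v x - v' x) * (v x - v' x)) = 0"
    by (intro antisym) auto
  moreover have "integrable lborel (\<lambda>x. (v x - v' x) * (v x - v' x))"
    using H_space_integrable_mult[OF \<Omega>] H_space_diff[OF \<Omega>] v by simp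
  ultimately have "AE x in lborel. (v x - v' x) * (v x - v' x) = 0"
    by (subst (asm) integral_nonneg_eq_0_iff_AE) auto
  then show ?thesis by eventually_elim auto
qed

section \<open>Moreau-Yosida approximation at a point \<open>u\<close> with a known resolvent
  \<open>v\<close>\<close>

context
  fixes \<Omega> :: "'a::euclidean_space set" and \<phi> :: "('a \<Rightarrow> real) \<Rightarrow> ereal"
    and \<mu> c :: real and u v \<xi> :: "'a \<Rightarrow> real"
  assumes \<Omega>: "\<Omega> \<in> sets borel" and \<mu>: "0 < \<mu>"
    and u: "u \<in> H_space \<Omega>" and v: "v \<in> H_space \<Omega>" and \<phi>v: "\<phi> v = ereal c"
    and \<xi>: "\<xi> \<in> subdiff_H \<Omega> \<phi> v"
    and ueq: "AE x in lborel. u x = v x + \<mu> * \<xi> x"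
begin

text \<open>A quadratic majorant, from the competitor \<open>v\<close> in the infimum.\<close>

lemma moreau_yosida_upper:
  assumes h: "h \<in> H_space \<Omega>"
  shows "moreau_yosida \<Omega> \<phi> \<mu> h \<le> ereal (1 / (2 * \<mu>) * (LINT x|lborel. (h x - v x) * (h x - v x)) + c)"
proof -
  have "moreau_yosida \<Omega> \<phi> \<mu> h \<le> ereal (1 / (2 * \<mu>) * (H_norm \<Omega> (\<lambda>x. h x - v x))\<^sup>2) + \<phi> v"
    unfolding moreau_yosida_def by (rule INF_lower[OF v])
  then show ?thesis
    unfolding \<phi>v H_norm_power2[OF \<Omega> H_space_diff[OF \<Omega> h v]] by simp
qed

text \<open>An affine minorant with slope \<xi>: the subgradient inequality at \<open>v\<close>
  bounds \<open>\<phi> y\<close> from below, and completing a square absorbs the quadratic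
  term.\<close>

lemma moreau_yosida_lower:
  assumes h: "h \<in> H_space \<Omega>"
  shows "ereal ((LINT x|lborel. \<xi> x * (h x - u x)) + \<mu> / 2 * (LINT x|lborel. \<xi> x * \<xi> x) + c)
    \<le> moreau_yosida \<Omega> \<phi> \<mu> h"
  unfolding moreau_yosida_def
proof (rule INF_greatest)
  fix y assume y: "y \<in> H_space \<Omega>"
  have \<xi>H: "\<xi> \<in> H_space \<Omega>" and sub: "ereal (LINT x|lborel. \<xi> x * (y x - v x)) \<le> \<phi> y - ereal c"
    using \<xi> y by (simp_all add: subdiff_H_iff[OF \<Omega> v] \<phi>v)
  note int = H_space_integrable_mult[OF \<Omega>]
  note diff = H_space_diff[OF \<Omega>]
  have [measurable]: "y \<in> borel_measurable borel" "h \<in> borel_measurable borel" "v \<in> borel_measurable borel"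
    "u \<in> borel_measurable borel" "\<xi> \<in> borel_measurable borel"
    using y h v u \<xi>H by auto
  note i = int[OF \<xi>H diff[OF h u]] int[OF \<xi>H \<xi>H] int[OF diff[OF h y] diff[OF h y]] int[OF \<xi>H diff[OF y v]]
  have "(LINT x|lborel. \<xi> x * (h x - u x) + \<mu> / 2 * (\<xi> x * \<xi> x))
      \<le> (LINT x|lborel. 1 / (2 * \<mu>) * ((h x - y x) * (h x - y x)) + \<xi> x * (y x - v x))"
  proof (rule integral_mono_AE)
    show "AE x in lborel. \<xi> x * (h x - u x) + \<mu> / 2 * (\<xi> x * \<xi> x)
      \<le> 1 / (2 * \<mu>) * ((h x - y x) * (h x - y x)) + \<xi> x * (y x - v x)"
      using ueq
    proof eventually_elim
      case (elim x)
      \<comment> \<open>This square vanishes for \<open>h = u\<close> and \<open>y = v\<close>,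
        which is why the minorant meets the quadratic majorant at \<open>u\<close>.\<close>
      have "0 \<le> 1 / (2 * \<mu>) * (h x - y x - \<mu> * \<xi> x)\<^sup>2" using \<mu> by simp
      also have "\<dots> = 1 / (2 * \<mu>) * ((h x - y x) * (h x - y x)) - \<xi> x * (h x - y x) + \<mu> / 2 * (\<xi> x * \<xi> x)"
        using \<mu> by (simp add: power2_eq_square field_simps)
      finally show ?case unfolding elim by (simp add: algebra_simps)
    qed
  qed (use i in \<open>auto intro!: Bochner_Integration.integrable_add integrable_mult_right\<close>)
  then have main: "(LINT x|lborel. \<xi> x * (h x - u x)) + \<mu> / 2 * (LINT x|lborel. \<xi> x * \<xi> x)
      \<le> 1 / (2 * \<mu>) * (LINT x|lborel. (h x - y x) * (h x - y x)) + (LINT x|lborel. \<xi> x * (y x - v x))"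
    using i by (simp add: Bochner_Integration.integral_add)
  show "ereal ((LINT x|lborel. \<xi> x * (h x - u x)) + \<mu> / 2 * (LINT x|lborel. \<xi> x * \<xi> x) + c)
      \<le> ereal (1 / (2 * \<mu>) * (H_norm \<Omega> (\<lambda>x. h x - y x))\<^sup>2) + \<phi> y"
    unfolding H_norm_power2[OF \<Omega> diff[OF h y]]
    using sub main by (cases "\<phi> y") auto
qed

lemma moreau_yosida_eq:
  "moreau_yosida \<Omega> \<phi> \<mu> u = ereal (\<mu> / 2 * (LINT x|lborel. \<xi> x * \<xi> x) + c)"
proof (rule antisym)
  have \<xi>H: "\<xi> \<in> H_space \<Omega>" using \<xi> by (simp add: subdiff_H_iff[OF \<Omega> v])
  have [measurable]: "v \<in> borel_measurable borel" "u \<in> borel_measurable borel" "\<xi> \<in> borel_measurable borel"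
    using v u \<xi>H by auto
  have "(LINT x|lborel. (u x - v x) * (u x - v x)) = (LINT x|lborel. \<mu>\<^sup>2 * (\<xi> x * \<xi> x))"
    using ueq by (intro integral_cong_AE) (auto simp: power2_eq_square)
  then have "1 / (2 * \<mu>) * (LINT x|lborel. (u x - v x) * (u x - v x)) = \<mu> / 2 * (LINT x|lborel. \<xi> x * \<xi> x)"
    using \<mu> by (simp add: power2_eq_square)
  from moreau_yosida_upper[OF u, unfolded this]
  show "moreau_yosida \<Omega> \<phi> \<mu> u \<le> ereal (\<mu> / 2 * (LINT x|lborel. \<xi> x * \<xi> x) + c)" .
  show "ereal (\<mu> / 2 * (LINT x|lborel. \<xi> x * \<xi> x) + c) \<le> moreau_yosida \<Omega> \<phi> \<mu> u"
    using moreau_yosida_lower[OF u] by simp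
qed

lemma moreau_yosida_subdiff: "\<xi> \<in> subdiff_H \<Omega> (moreau_yosida \<Omega> \<phi> \<mu>) u"
  unfolding subdiff_H_iff[OF \<Omega> u] moreau_yosida_eq
proof (intro conjI ballI)
  show "\<xi> \<in> H_space \<Omega>" using \<xi> by (simp add: subdiff_H_iff[OF \<Omega> v])
  fix h assume "h \<in> H_space \<Omega>"
  from moreau_yosida_lower[OF this]
  show "ereal (LINT x|lborel. \<xi> x * (h x - u x))
      \<le> moreau_yosida \<Omega> \<phi> \<mu> h - ereal (\<mu> / 2 * (LINT x|lborel. \<xi> x * \<xi> x) + c)"
    by (cases "moreau_yosida \<Omega> \<phi> \<mu> h") auto
qed simp

text \<open>A subgradient \<open>w\<close> gives an affine minorant touching at \<open>u\<close>.
  Lying below the quadratic majorant that touches there too, it must have slope \<xi>: the integral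
  of the square of \<open>w x - \<xi> x\<close> comes out nonpositive.\<close>

lemma moreau_yosida_subdiff_unique:
  assumes w: "w \<in> subdiff_H \<Omega> (moreau_yosida \<Omega> \<phi> \<mu>) u"
  shows "AE x in lborel. w x = \<xi> x"
proof -
  have \<xi>H: "\<xi> \<in> H_space \<Omega>" using \<xi> by (simp add: subdiff_H_iff[OF \<Omega> v])
  have wH: "w \<in> H_space \<Omega>" using w by (simp add: subdiff_H_iff[OF \<Omega> u])
  note int = H_space_integrable_mult[OF \<Omega>]
  note diff = H_space_diff[OF \<Omega>]
  have [measurable]: "v \<in> borel_measurable borel" "w \<in> borel_measurable borel"
    "u \<in> borel_measurable borel" "\<xi> \<in> borel_measurable borel"
    using v u \<xi>H wH by auto
  \<comment> \<open>This test function maximises the gap between the two one-sided bounds.\<close>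
  define h where "h = (\<lambda>x. 1 * v x + \<mu> * w x)"
  have hH: "h \<in> H_space \<Omega>" unfolding h_def by (rule H_space_lincomb[OF \<Omega> v wH])
  then have [measurable]: "h \<in> borel_measurable borel" by auto
  have "ereal (LINT x|lborel. w x * (h x - u x)) \<le> moreau_yosida \<Omega> \<phi> \<mu> h - moreau_yosida \<Omega> \<phi> \<mu> u"
    using w hH by (simp add: subdiff_H_iff[OF \<Omega> u])
  also have "\<dots> \<le> ereal (1 / (2 * \<mu>) * (LINT x|lborel. (h x - v x) * (h x - v x)) + c)
      - ereal (\<mu> / 2 * (LINT x|lborel. \<xi> x * \<xi> x) + c)"
    unfolding moreau_yosida_eq using moreau_yosida_upper[OF hH] by (intro ereal_minus_mono) auto
  finally have le: "(LINT x|lborel. w x * (h x - u x))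
      \<le> 1 / (2 * \<mu>) * (LINT x|lborel. (h x - v x) * (h x - v x)) - \<mu> / 2 * (LINT x|lborel. \<xi> x * \<xi> x)"
    by simp
  have "(LINT x|lborel. (h x - v x) * (h x - v x)) = \<mu>\<^sup>2 * (LINT x|lborel. w x * w x)"
    by (subst integral_mult_right_zero[symmetric])
       (intro Bochner_Integration.integral_cong, auto simp: h_def power2_eq_square)
  moreover have "(LINT x|lborel. w x * (h x - u x)) = (LINT x|lborel. \<mu> * (w x * w x) - \<mu> * (w x * \<xi> x))"
    using ueq by (intro integral_cong_AE) (auto simp: h_def algebra_simps)
  moreover have "\<dots> = \<mu> * (LINT x|lborel. w x * w x) - \<mu> * (LINT x|lborel. w x * \<xi> x)"
    using int \<xi>H wH by (subst Bochner_Integration.integral_diff) auto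
  ultimately have "\<mu> * ((LINT x|lborel. w x * w x) - 2 * (LINT x|lborel. w x * \<xi> x) + (LINT x|lborel. \<xi> x * \<xi> x)) \<le> 0"
    using le \<mu> by (simp add: power2_eq_square field_simps)
  then have "(LINT x|lborel. w x * w x) - 2 * (LINT x|lborel. w x * \<xi> x) + (LINT x|lborel. \<xi> x * \<xi> x) \<le> 0"
    using \<mu> by (simp add: mult_le_0_iff)
  also have "(LINT x|lborel. w x * w x) - 2 * (LINT x|lborel. w x * \<xi> x) + (LINT x|lborel. \<xi> x * \<xi> x)
      = (LINT x|lborel. w x * w x - 2 * (w x * \<xi> x) + \<xi> x * \<xi> x)"
    using int \<xi>H wH by simp
  also have "\<dots> = (LINT x|lborel. (w x - \<xi> x) * (w x - \<xi> x))"
    by (intro Bochner_Integration.integral_cong) (auto simp: algebra_simps)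
  finally have "(LINT x|lborel. (w x - \<xi> x) * (w x - \<xi> x)) = 0"
    by (intro antisym) auto
  then have "AE x in lborel. (w x - \<xi> x) * (w x - \<xi> x) = 0"
    using int[OF diff diff, OF wH \<xi>H wH \<xi>H] by (subst (asm) integral_nonneg_eq_0_iff_AE) auto
  then show ?thesis by eventually_elim auto
qed

text \<open>\<xi> witnesses that the choice by \<open>SOME\<close> is made from a nonempty set, and
  uniqueness identifies the chosen representative up to a null set.\<close>

lemma moreau_yosida_deriv_AE_eq:
  "moreau_yosida_deriv \<Omega> \<phi> \<mu> u \<in> borel_measurable borel"
  "AE x in lborel. moreau_yosida_deriv \<Omega> \<phi> \<mu> u x = \<xi> x"
proof -
  have w: "moreau_yosida_deriv \<Omega> \<phi> \<mu> u \<in> subdiff_H \<Omega> (moreau_yosida \<Omega> \<phi> \<mu>) u"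
    unfolding moreau_yosida_deriv_def by (rule someI[of "\<lambda>w. w \<in> _"]) (rule moreau_yosida_subdiff)
  then show "moreau_yosida_deriv \<Omega> \<phi> \<mu> u \<in> borel_measurable borel"
    by (auto simp: subdiff_H_iff[OF \<Omega> u])
  show "AE x in lborel. moreau_yosida_deriv \<Omega> \<phi> \<mu> u x = \<xi> x"
    by (rule moreau_yosida_subdiff_unique[OF w])
qed

lemma resolvent_H_AE_eq:
  assumes "\<And>h. h \<in> H_space \<Omega> \<Longrightarrow> \<phi> h \<noteq> -\<infinity>"
  shows "resolvent_H \<Omega> \<phi> \<mu> u \<in> borel_measurable borel"
    "AE x in lborel. resolvent_H \<Omega> \<phi> \<mu> u x = v x"
proof -
  have "resolvent_H \<Omega> \<phi> \<mu> u \<in> H_space \<Omega> \<and>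
      (\<exists>\<xi>\<in>subdiff_H \<Omega> \<phi> (resolvent_H \<Omega> \<phi> \<mu> u). AE x in lborel. u x = resolvent_H \<Omega> \<phi> \<mu> u x + \<mu> * \<xi> x)"
    unfolding resolvent_H_def by (rule someI[where x = v]) (use v \<xi> ueq in auto)
  then obtain \<xi>' where *: "resolvent_H \<Omega> \<phi> \<mu> u \<in> H_space \<Omega>"
      "\<xi>' \<in> subdiff_H \<Omega> \<phi> (resolvent_H \<Omega> \<phi> \<mu> u)"
      "AE x in lborel. u x = resolvent_H \<Omega> \<phi> \<mu> u x + \<mu> * \<xi>' x" by blast
  then show "resolvent_H \<Omega> \<phi> \<mu> u \<in> borel_measurable borel" by auto
  show "AE x in lborel. resolvent_H \<Omega> \<phi> \<mu> u x = v x"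
    by (rule resolvent_unique_AE[OF \<Omega> \<mu> *(1) v _ _ *(2) \<xi> *(3) ueq]) (use assms * v in auto)
qed

end

text \<open>The tangent inequality at \<open>v x\<close>, integrated. For \<open>h\<close> outside
  \<open>L^r\<close> the right-hand side is infinite.\<close>

lemma power_energy_subdiff:
  assumes \<Omega>: "\<Omega> \<in> sets borel" and r: "1 < r"
    and v: "v \<in> H_space \<Omega>" "v \<in> Lebesgue_space \<Omega> r"
    and \<xi>: "(\<lambda>x. signed_powr (r - 2) (v x)) \<in> H_space \<Omega>"
  shows "(\<lambda>x. signed_powr (r - 2) (v x)) \<in> subdiff_H \<Omega> (power_energy \<Omega> r) v"
  unfolding subdiff_H_iff[OF \<Omega> v(1)]
proof (intro conjI ballI \<xi>)
  show "power_energy \<Omega> r v \<noteq> \<infinity>" using v by (simp add: power_energy_def)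
  fix h assume h: "h \<in> H_space \<Omega>"
  show "ereal (LINT x|lborel. signed_powr (r - 2) (v x) * (h x - v x))
      \<le> power_energy \<Omega> r h - power_energy \<Omega> r v"
  proof (cases "h \<in> Lebesgue_space \<Omega> r")
    case True
    have i: "integrable lborel (\<lambda>x. \<bar>v x\<bar> powr r)" "integrable lborel (\<lambda>x. \<bar>h x\<bar> powr r)"
      using v True \<Omega> by (auto simp: Lebesgue_space_iff)
    have "(LINT x|lborel. signed_powr (r - 2) (v x) * (h x - v x))
        \<le> (LINT x|lborel. \<bar>h x\<bar> powr r / r - \<bar>v x\<bar> powr r / r)"
      using H_space_integrable_mult[OF \<Omega> \<xi> H_space_diff[OF \<Omega> h v(1)]] i powr_tangent[OF r]
      by (intro integral_mono) (auto simp: algebra_simps)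
    also have "\<dots> = (LINT x|lborel. \<bar>h x\<bar> powr r) / r - (LINT x|lborel. \<bar>v x\<bar> powr r) / r"
      using i by simp
    finally show ?thesis
      using True v by (simp add: power_energy_def Lebesgue_space_set_integral[OF \<Omega>])
  qed (use v in \<open>simp add: power_energy_def\<close>)
qed

subsection \<open>The fractional energy\<close>

text \<open>The singular kernel is moved into the measure, so that the Gagliardo seminorm becomes an
  ordinary \<open>L\<^sup>p\<close> seminorm of the difference \<open>u x - u y\<close>.\<close>

definition gagliardo_measure :: "real \<Rightarrow> real \<Rightarrow> ('a::euclidean_space \<times> 'a) measure" where
  "gagliardo_measure s p = density (lborel \<Otimes>\<^sub>M lborel)
     (\<lambda>z. ennreal (1 / norm (fst z - snd z) powr (real DIM('a) + s * p)))"

lemma sets_gagliardo_measure [measurable_cong]: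
  "sets (gagliardo_measure s p) = sets (borel \<Otimes>\<^sub>M borel)"
  by (simp add: gagliardo_measure_def cong: sets_pair_measure_cong)

text \<open>Tonelli and the density formula. On the diagonal the kernel has the HOL value
  \<open>1 / 0 = 0\<close>, in agreement with the quotient in
  \<open>gagliardo_ennreal\<close>.\<close>

lemma gagliardo_ennreal_eq:
  fixes u :: "'a::euclidean_space \<Rightarrow> real"
  assumes [measurable]: "u \<in> borel_measurable borel"
  shows "gagliardo_ennreal s p u =
    (\<integral>\<^sup>+z. ennreal (\<bar>u (fst z) - u (snd z)\<bar> powr p) \<partial>gagliardo_measure s p)"
proof -
  let ?k = "\<lambda>z :: 'a \<times> 'a. 1 / norm (fst z - snd z) powr (real DIM('a) + s * p)"
  let ?f = "\<lambda>z. \<bar>u (fst z) - u (snd z)\<bar> powr p"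
  have "gagliardo_ennreal s p u
      = (\<integral>\<^sup>+x. \<integral>\<^sup>+y. ennreal (?k (x, y)) * ennreal (?f (x, y)) \<partial>lborel \<partial>lborel)"
    unfolding gagliardo_ennreal_def by (intro nn_integral_cong) (simp flip: ennreal_mult)
  also have "\<dots> = (\<integral>\<^sup>+z. ennreal (?k z) * ennreal (?f z) \<partial>(lborel \<Otimes>\<^sub>M lborel))"
    by (rule lborel.nn_integral_fst) measurable
  also have "\<dots> = (\<integral>\<^sup>+z. ennreal (?f z) \<partial>gagliardo_measure s p)"
    unfolding gagliardo_measure_def by (rule nn_integral_density[symmetric]) measurable
  finally show ?thesis .
qed

text \<open>A null set in one variable yields null sets of pairs in either coordinate, and a density
  adds no new charged sets. Representatives can thus be exchanged under the double integral.\<close>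

lemma AE_gagliardo_measure:
  fixes u v :: "'a::euclidean_space \<Rightarrow> real"
  assumes [measurable]: "u \<in> borel_measurable borel" "v \<in> borel_measurable borel"
    and eq: "AE x in lborel. u x = v x"
  shows "AE z in gagliardo_measure s p. u (fst z) = v (fst z) \<and> u (snd z) = v (snd z)"
proof -
  have "AE z in (lborel \<Otimes>\<^sub>M lborel :: ('a \<times> 'a) measure). u (fst z) = v (fst z) \<and> u (snd z) = v (snd z)"
  proof (rule lborel_pair.AE_pair_measure)
    show "AE x in lborel. AE y in lborel. u (fst (x, y)) = v (fst (x, y)) \<and> u (snd (x, y)) = v (snd (x, y))"
      using eq
    proof eventually_elim
      case (elim x)
      show ?case using eq by eventually_elim (use elim in auto)
    qed
  qed measurable
  then show ?thesis
    unfolding gagliardo_measure_def by (subst AE_density) auto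
qed

lemma gagliardo_ennreal_cong_AE:
  fixes u v :: "'a::euclidean_space \<Rightarrow> real"
  assumes "u \<in> borel_measurable borel" "v \<in> borel_measurable borel" "AE x in lborel. u x = v x"
  shows "gagliardo_ennreal s p u = gagliardo_ennreal s p v"
  unfolding gagliardo_ennreal_eq[OF assms(1)] gagliardo_ennreal_eq[OF assms(2)]
proof (rule nn_integral_cong_AE)
  show "AE z in gagliardo_measure s p. ennreal (\<bar>u (fst z) - u (snd z)\<bar> powr p)
      = ennreal (\<bar>v (fst z) - v (snd z)\<bar> powr p)"
    using AE_gagliardo_measure[OF assms] by eventually_elim auto
qed

lemma frac_Sobolev_integral:
  fixes u :: "'a::euclidean_space \<Rightarrow> real"
  assumes "u \<in> frac_Sobolev s p"
  shows "integrable (gagliardo_measure s p) (\<lambda>z. \<bar>u (fst z) - u (snd z)\<bar> powr p)"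
    and "gagliardo s p u = (LINT z|gagliardo_measure s p. \<bar>u (fst z) - u (snd z)\<bar> powr p)"
proof -
  have [measurable]: "u \<in> borel_measurable borel"
    and fin: "gagliardo_ennreal s p u < \<infinity>"
    using assms by (auto simp: frac_Sobolev_def)
  have meas: "(\<lambda>z. \<bar>u (fst z) - u (snd z)\<bar> powr p) \<in> borel_measurable (gagliardo_measure s p)"
    by measurable
  show "integrable (gagliardo_measure s p) (\<lambda>z. \<bar>u (fst z) - u (snd z)\<bar> powr p)"
    by (rule integrableI_nonneg) (use fin meas in \<open>auto simp: gagliardo_ennreal_eq\<close>)
  show "gagliardo s p u = (LINT z|gagliardo_measure s p. \<bar>u (fst z) - u (snd z)\<bar> powr p)"
    unfolding gagliardo_def gagliardo_ennreal_eq[OF \<open>u \<in> borel_measurable borel\<close>]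
    by (rule enn2real_nn_integral_eq_integral) (use fin meas in \<open>auto simp: gagliardo_ennreal_eq\<close>)
qed

lemma gagliardo_nonneg: "0 \<le> gagliardo s p u"
  by (simp add: gagliardo_def)

lemma frac_Sobolev0_measurable [measurable_dest]:
  "u \<in> frac_Sobolev0 \<Omega> s p \<Longrightarrow> u \<in> borel_measurable borel"
  by (auto simp: frac_Sobolev0_def frac_Sobolev_def)

text \<open>The Lipschitz bound scales the Gagliardo integrand by at most \<open>c powr p\<close>;
  together with \<open>F 0 = 0\<close> it also controls the \<open>L^p\<close> part and the values
  outside \<Omega>. Equality of \<open>f\<close> and the composition is only almost everywhere
  because \<open>f\<close> will be a chosen representative.\<close>

lemma frac_Sobolev0_lipschitz:
  fixes u f :: "'a::euclidean_space \<Rightarrow> real"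
  assumes p: "0 \<le> p" and u: "u \<in> frac_Sobolev0 \<Omega> s p"
    and f: "f \<in> borel_measurable borel" and feq: "AE x in lborel. f x = F (u x)"
    and F: "F \<in> borel_measurable borel"
    and F0: "F 0 = 0" and lip: "\<And>a b. \<bar>F a - F b\<bar> \<le> c * \<bar>a - b\<bar>" and c: "0 \<le> c"
  shows "f \<in> frac_Sobolev0 \<Omega> s p"
proof -
  have um [measurable]: "u \<in> borel_measurable borel" using u by auto
  have uS: "u \<in> frac_Sobolev s p" "u \<in> Lebesgue_space UNIV p" "gagliardo_ennreal s p u < \<infinity>"
    and uz: "AE x in lborel. x \<notin> \<Omega> \<longrightarrow> u x = 0"
    using u by (auto simp: frac_Sobolev0_def frac_Sobolev_def)
  have [measurable]: "F \<in> borel_measurable borel" by (rule F)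
  have bound: "\<bar>F a\<bar> \<le> c * \<bar>a\<bar>" for a using lip[of a 0] F0 by simp
  have "f \<in> Lebesgue_space UNIV p"
    by (rule Lebesgue_space_dominated[OF _ p uS(2) f c]) (use feq bound in auto)
  moreover have "AE x in lborel. x \<notin> \<Omega> \<longrightarrow> f x = 0"
    using uz feq by eventually_elim (auto simp: F0)
  moreover have "gagliardo_ennreal s p f < \<infinity>"
  proof -
    have "gagliardo_ennreal s p f = gagliardo_ennreal s p (\<lambda>x. F (u x))"
      by (rule gagliardo_ennreal_cong_AE[OF f _ feq]) measurable
    also have "\<dots> = (\<integral>\<^sup>+z. ennreal (\<bar>F (u (fst z)) - F (u (snd z))\<bar> powr p) \<partial>gagliardo_measure s p)"
      by (rule gagliardo_ennreal_eq) measurable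
    also have "\<dots> \<le> (\<integral>\<^sup>+z. ennreal (c powr p) * ennreal (\<bar>u (fst z) - u (snd z)\<bar> powr p) \<partial>gagliardo_measure s p)"
    proof (rule nn_integral_mono)
      fix z :: "'a \<times> 'a"
      have "\<bar>F (u (fst z)) - F (u (snd z))\<bar> powr p \<le> (c * \<bar>u (fst z) - u (snd z)\<bar>) powr p"
        using p by (intro powr_mono2 lip) auto
      then show "ennreal (\<bar>F (u (fst z)) - F (u (snd z))\<bar> powr p)
          \<le> ennreal (c powr p) * ennreal (\<bar>u (fst z) - u (snd z)\<bar> powr p)"
        using c by (simp add: powr_mult ennreal_leI flip: ennreal_mult)
    qed
    also have "\<dots> = ennreal (c powr p) * gagliardo_ennreal s p u"
      unfolding gagliardo_ennreal_eq[OF um] by (rule nn_integral_cmult) measurable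
    also have "\<dots> < \<infinity>" using uS(3) by (simp add: ennreal_mult_less_top)
    finally show ?thesis .
  qed
  ultimately show ?thesis by (simp add: frac_Sobolev0_def frac_Sobolev_def)
qed

lemma V_space_lipschitz:
  fixes u f :: "'a::euclidean_space \<Rightarrow> real"
  assumes "\<Omega> \<in> sets borel" "0 \<le> p" "0 \<le> r" and u: "u \<in> V_space \<Omega> s p r"
    and f: "f \<in> borel_measurable borel" and feq: "AE x in lborel. f x = F (u x)"
    and F: "F \<in> borel_measurable borel"
    and F0: "F 0 = 0" and lip: "\<And>a b. \<bar>F a - F b\<bar> \<le> c * \<bar>a - b\<bar>" and c: "0 \<le> c"
  shows "f \<in> V_space \<Omega> s p r"
proof -
  have "\<bar>F a\<bar> \<le> c * \<bar>a\<bar>" for a using lip[of a 0] F0 by simp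
  then have "f \<in> Lebesgue_space \<Omega> r"
    using u feq by (intro Lebesgue_space_dominated[OF assms(1,3) _ f c, of u]) (auto simp: V_space_def)
  moreover have "f \<in> frac_Sobolev0 \<Omega> s p"
    by (rule frac_Sobolev0_lipschitz[OF assms(2) _ f feq F F0 lip c]) (use u in \<open>simp add: V_space_def\<close>)
  ultimately show ?thesis by (simp add: V_space_def)
qed

section \<open>A subgradient of the fractional energy at each point of \<open>V\<close>\<close>

lemma frac_const_pos:
  assumes "0 < s" "s < 1" "2 \<le> p" "0 < N" shows "0 < frac_const N p s"
proof -
  have "0 < p * s" using assms by simp
  then have "0 < p * s + p + real N - 2" using assms by linarith
  then show ?thesis using assms unfolding frac_const_def
    by (intro divide_pos_pos mult_pos_pos Gamma_real_pos) auto
qed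

text \<open>The subgradient \<open>g\<close> at \<open>v\<close> is the weak fractional
  \<open>p\<close>-Laplacian of \<open>v\<close>, and the subgradient inequality is the tangent
  inequality at \<open>D v z\<close>, integrated.\<close>

lemma V_space_subset_subdiff_dom:
  fixes \<Omega> :: "'a::euclidean_space set"
  assumes "0 < s" "s < 1" "2 \<le> p"
  shows "V_space \<Omega> s p r \<subseteq> subdiff_dom (V_space \<Omega> s p r) (V_norm \<Omega> s p r) (frac_energy s p)"
proof
  fix v assume v: "v \<in> V_space \<Omega> s p r"
  define M :: "('a \<times> 'a) measure" where "M = gagliardo_measure s p"
  define C where "C = frac_const DIM('a) p s"
  define D where "D = (\<lambda>(h :: 'a \<Rightarrow> real) z. h (fst z) - h (snd z))"
  define g where "g h = C / 2 * (LINT z|M. signed_powr (p - 2) (D v z) * D h z)" for h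
  have C: "0 < C" using assms by (simp add: C_def frac_const_pos)
  have p: "1 < p" "0 < p" using assms by auto
  have mV: "D h \<in> borel_measurable M" if "h \<in> V_space \<Omega> s p r" for h
  proof -
    have [measurable]: "h \<in> borel_measurable borel" using that by (auto simp: V_space_def)
    show ?thesis unfolding D_def M_def by measurable
  qed
  have iV: "integrable M (\<lambda>z. \<bar>D h z\<bar> powr p)" and GV: "gagliardo s p h = (LINT z|M. \<bar>D h z\<bar> powr p)"
    if "h \<in> V_space \<Omega> s p r" for h
    using frac_Sobolev_integral[of h s p] that by (auto simp: V_space_def frac_Sobolev0_def D_def M_def)
  have int: "integrable M (\<lambda>z. signed_powr (p - 2) (D v z) * D h z)" if "h \<in> V_space \<Omega> s p r" for h
    using that v by (intro integrable_signed_powr_mult(1) p mV iV)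
  \<comment> \<open>The constant of the non-sharp Hoelder bound; the factor
    \<open>(2 / C) powr (1 / p)\<close> converts the bare seminorm into
    \<open>frac_Sobolev0_norm\<close>.\<close>
  define K where "K = C / 2 * ((LINT z|M. \<bar>D v z\<bar> powr p) + 1) * (2 / C) powr (1 / p)"
  have K: "0 \<le> K" using C by (auto simp: K_def intro!: mult_nonneg_nonneg add_nonneg_nonneg)
  have bound: "\<bar>g h\<bar> \<le> K * V_norm \<Omega> s p r h" if h: "h \<in> V_space \<Omega> s p r" for h
  proof -
    have "\<bar>g h\<bar> = C / 2 * \<bar>LINT z|M. signed_powr (p - 2) (D v z) * D h z\<bar>"
      using C by (simp add: g_def abs_mult)
    also have "\<dots> \<le> C / 2 * (((LINT z|M. \<bar>D v z\<bar> powr p) + 1) * (LINT z|M. \<bar>D h z\<bar> powr p) powr (1 / p))"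
      using C h v by (intro mult_left_mono integral_signed_powr_mult_le_norm p mV iV) auto
    also have "\<dots> = K * frac_Sobolev0_norm s p h"
    proof -
      have "gagliardo s p h = 2 / C * (C / 2 * gagliardo s p h)" using C by simp
      then have "gagliardo s p h powr (1 / p) = (2 / C) powr (1 / p) * (C / 2 * gagliardo s p h) powr (1 / p)"
        using C gagliardo_nonneg[of s p h] by (metis powr_mult less_imp_le zero_less_divide_iff
            mult_nonneg_nonneg zero_less_numeral)
      then show ?thesis by (simp add: K_def frac_Sobolev0_norm_def C_def GV[OF h, symmetric])
    qed
    also have "\<dots> \<le> K * V_norm \<Omega> s p r h"
      unfolding V_norm_def by (intro mult_left_mono K real_le_rsqrt) auto
    finally show ?thesis .
  qed
  have dual: "g \<in> dual_space (V_space \<Omega> s p r) (V_norm \<Omega> s p r)"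
    unfolding dual_space_def
  proof (intro CollectI conjI ballI allI exI[of _ K] bound)
    fix h k assume hk: "h \<in> V_space \<Omega> s p r" "k \<in> V_space \<Omega> s p r"
    have "(LINT z|M. signed_powr (p - 2) (D v z) * D (\<lambda>x. h x + k x) z)
        = (LINT z|M. signed_powr (p - 2) (D v z) * D h z + signed_powr (p - 2) (D v z) * D k z)"
      by (intro Bochner_Integration.integral_cong) (auto simp: D_def algebra_simps)
    also have "\<dots> = (LINT z|M. signed_powr (p - 2) (D v z) * D h z)
        + (LINT z|M. signed_powr (p - 2) (D v z) * D k z)"
      by (rule Bochner_Integration.integral_add) (intro int hk)+
    finally show "g (\<lambda>x. h x + k x) = g h + g k" by (simp add: g_def distrib_left)
  next
    fix c h
    have "(LINT z|M. signed_powr (p - 2) (D v z) * D (\<lambda>x. c * h x) z)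
        = (LINT z|M. c * (signed_powr (p - 2) (D v z) * D h z))"
      by (intro Bochner_Integration.integral_cong) (auto simp: D_def algebra_simps)
    then show "g (\<lambda>x. c * h x) = c * g h" by (simp add: g_def)
  qed
  have "g (\<lambda>x. h x - v x) \<le> C / (2 * p) * gagliardo s p h - C / (2 * p) * gagliardo s p v"
    if h: "h \<in> V_space \<Omega> s p r" for h
  proof -
    have "(LINT z|M. signed_powr (p - 2) (D v z) * D (\<lambda>x. h x - v x) z)
        = (LINT z|M. signed_powr (p - 2) (D v z) * D h z - signed_powr (p - 2) (D v z) * D v z)"
      by (intro Bochner_Integration.integral_cong) (auto simp: D_def algebra_simps)
    also have "\<dots> \<le> (LINT z|M. \<bar>D h z\<bar> powr p / p - \<bar>D v z\<bar> powr p / p)"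
    proof (rule integral_mono)
      show "signed_powr (p - 2) (D v z) * D h z - signed_powr (p - 2) (D v z) * D v z
          \<le> \<bar>D h z\<bar> powr p / p - \<bar>D v z\<bar> powr p / p" for z
        using powr_tangent[OF p(1), of "D v z" "D h z"] by (simp add: right_diff_distrib)
    qed (use int iV h v in auto)
    also have "\<dots> = gagliardo s p h / p - gagliardo s p v / p"
      using iV[OF h] iV[OF v] by (simp add: GV h v)
    finally have "g (\<lambda>x. h x - v x) \<le> C / 2 * (gagliardo s p h / p - gagliardo s p v / p)"
      unfolding g_def using C by (intro mult_left_mono) auto
    then show ?thesis by (simp add: right_diff_distrib)
  qed
  then have "g \<in> subdiff (V_space \<Omega> s p r) (V_norm \<Omega> s p r) (frac_energy s p) v"
    using dual by (simp add: subdiff_def frac_energy_def C_def)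
  then show "v \<in> subdiff_dom (V_space \<Omega> s p r) (V_norm \<Omega> s p r) (frac_energy s p)"
    using v by (auto simp: subdiff_dom_def)
qed

section \<open>Membership of the three functions and the energy inequality\<close>

theorem lemma3p10:
  fixes \<Omega> :: "'a::euclidean_space set"
    and s p q r :: real
    and u u0 :: "'a \<Rightarrow> real"
    and \<sigma> :: ereal
  assumes "open \<Omega>" and "bounded \<Omega>"
    and "0 < s" and "s < 1"
    and "2 \<le> p" and "2 \<le> q" and "2 \<le> r"
    and "p < q"
    and "r > real DIM('a) * (q - p) / (s * p)"
    and "u0 \<in> V_space \<Omega> s p r"
    and "\<sigma> = power_energy \<Omega> r u0 + 1"
    and "u \<in> subdiff_dom (V_space \<Omega> s p r) (V_norm \<Omega> s p r) (frac_energy s p)"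
  shows
    "(\<forall>\<mu>>0.
        resolvent_H \<Omega> (power_energy \<Omega> r) \<mu> u
          \<in> subdiff_dom (V_space \<Omega> s p r) (V_norm \<Omega> s p r) (frac_energy s p) \<and>
        moreau_yosida_deriv \<Omega> (power_energy \<Omega> r) \<mu> u \<in> V_space \<Omega> s p r \<and>
        resolvent_power \<Omega> p r \<mu> u \<in> frac_Sobolev0 \<Omega> s p) \<and>
     (u \<in> subdiff_dom (V_space \<Omega> s p r) (V_norm \<Omega> s p r) (frac_energy_trunc \<Omega> s p r \<sigma>) \<longrightarrow>
       (\<exists>\<beta>>0. \<forall>\<mu>>0.
          \<forall>g \<in> subdiff (V_space \<Omega> s p r) (V_norm \<Omega> s p r) (frac_energy_trunc \<Omega> s p r \<sigma>) u.
            \<beta> * frac_const DIM('a) p s / 2 * gagliardo s p (resolvent_power \<Omega> p r \<mu> u)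
              \<le> g (moreau_yosida_deriv \<Omega> (power_energy \<Omega> r) \<mu> u)))"
proof -
  have \<Omega>: "\<Omega> \<in> sets borel" using assms(1) by simp
  have p: "1 < p" "0 \<le> p" "0 < p" and r: "1 < r" "0 \<le> r" "0 < r" using assms by auto
  have u: "u \<in> V_space \<Omega> s p r" using assms by (simp add: subdiff_dom_def)
  then have ur: "u \<in> Lebesgue_space \<Omega> r" by (simp add: V_space_def)
  then have uH: "u \<in> H_space \<Omega>"
    using assms by (intro Lebesgue_space_bounded_mono[OF \<Omega> assms(2) _ _ ur]) auto
  have [measurable]: "u \<in> borel_measurable borel" using ur by auto
  let ?J = "\<lambda>\<mu>. resolvent_H \<Omega> (power_energy \<Omega> r) \<mu> u"
  let ?W = "\<lambda>\<mu>. moreau_yosida_deriv \<Omega> (power_energy \<Omega> r) \<mu> u"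
  let ?P = "\<lambda>\<mu>. resolvent_power \<Omega> p r \<mu> u"
  let ?F = "\<lambda>\<mu> t. signed_powr ((r - 2) / p) (shrink r \<mu> t)"
  let ?X = "\<lambda>\<mu> t. signed_powr (r - 2) (shrink r \<mu> t)"
  \<comment> \<open>Both objects are choices by \<open>SOME\<close>. The composition of
    \<open>shrink r \<mu>\<close> with \<open>u\<close>, together with its odd power, solves the
    resolvent equation, so the choices agree with this explicit pair almost everywhere.\<close>
  have J: "?J \<mu> \<in> borel_measurable borel" "AE x in lborel. ?J \<mu> x = shrink r \<mu> (u x)"
    and W: "?W \<mu> \<in> borel_measurable borel" "AE x in lborel. ?W \<mu> x = ?X \<mu> (u x)"
    if \<mu>: "0 < \<mu>" for \<mu>
  proof -
    note [measurable] = borel_measurable_shrink[OF \<open>2 \<le> r\<close> \<mu>]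
    have v: "(\<lambda>x. shrink r \<mu> (u x)) \<in> Lebesgue_space \<Omega> q'" if "0 \<le> q'" "u \<in> Lebesgue_space \<Omega> q'" for q'
      using abs_shrink_le[OF \<open>2 \<le> r\<close> \<mu>]
      by (intro Lebesgue_space_dominated[OF \<Omega> that(1,2), of _ 1]) auto
    have vH: "(\<lambda>x. shrink r \<mu> (u x)) \<in> H_space \<Omega>" and vr: "(\<lambda>x. shrink r \<mu> (u x)) \<in> Lebesgue_space \<Omega> r"
      using v uH ur r by auto
    have "\<bar>?X \<mu> t\<bar> \<le> 1 / \<mu> * \<bar>t\<bar>" for t
      using signed_powr_shrink_lipschitz[OF \<open>2 \<le> r\<close> \<mu>, of t 0] \<mu> assms by simp
    then have xH: "(\<lambda>x. ?X \<mu> (u x)) \<in> H_space \<Omega>"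
      using \<mu> by (intro Lebesgue_space_dominated[OF \<Omega> _ uH, of _ "1 / \<mu>"]) auto
    have \<phi>v: "power_energy \<Omega> r (\<lambda>x. shrink r \<mu> (u x))
        = ereal (1 / r * (LINT x:\<Omega>|lborel. \<bar>shrink r \<mu> (u x)\<bar> powr r))"
      using vr by (simp add: power_energy_def)
    have ueq: "AE x in lborel. u x = shrink r \<mu> (u x) + \<mu> * ?X \<mu> (u x)"
      using shrink_eq[OF \<open>2 \<le> r\<close> \<mu>] by simp
    note sub = power_energy_subdiff[OF \<Omega> r(1) vH vr xH]
    show "?J \<mu> \<in> borel_measurable borel" "AE x in lborel. ?J \<mu> x = shrink r \<mu> (u x)"
      using resolvent_H_AE_eq[OF \<Omega> \<mu> uH vH \<phi>v sub ueq] by (auto simp: power_energy_def)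
    show "?W \<mu> \<in> borel_measurable borel" "AE x in lborel. ?W \<mu> x = ?X \<mu> (u x)"
      using moreau_yosida_deriv_AE_eq[OF \<Omega> \<mu> uH vH \<phi>v sub ueq] by auto
  qed
  have P: "?P \<mu> \<in> borel_measurable borel" "AE x in lborel. ?P \<mu> x = ?F \<mu> (u x)" if "0 < \<mu>" for \<mu>
  proof -
    note [measurable] = J(1)[OF that]
    have eq: "?P \<mu> = (\<lambda>x. signed_powr ((r - 2) / p) (?J \<mu> x))"
      by (simp add: resolvent_power_def signed_powr_def)
    show "?P \<mu> \<in> borel_measurable borel" unfolding eq by measurable
    show "AE x in lborel. ?P \<mu> x = ?F \<mu> (u x)"
      unfolding eq using J(2)[OF that] by eventually_elim simp
  qed
  \<comment> \<open>All three are, almost everywhere, Lipschitz functions of \<open>u\<close> that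
    fix 0.\<close>
  have JV: "?J \<mu> \<in> V_space \<Omega> s p r" and WV: "?W \<mu> \<in> V_space \<Omega> s p r"
    and PW: "?P \<mu> \<in> frac_Sobolev0 \<Omega> s p" if \<mu>: "0 < \<mu>" for \<mu>
  proof -
    note [measurable] = borel_measurable_shrink[OF \<open>2 \<le> r\<close> \<mu>]
    note s0 = shrink_0[OF \<open>2 \<le> r\<close> \<mu>]
    show "?J \<mu> \<in> V_space \<Omega> s p r"
      using shrink_lipschitz[OF \<open>2 \<le> r\<close> \<mu>] s0
      by (intro V_space_lipschitz[OF \<Omega> p(2) r(2) u J[OF \<mu>], of 1]) auto
    show "?W \<mu> \<in> V_space \<Omega> s p r"
      using signed_powr_shrink_lipschitz[OF \<open>2 \<le> r\<close> \<mu>] s0 \<mu>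
      by (intro V_space_lipschitz[OF \<Omega> p(2) r(2) u W[OF \<mu>], of "1 / \<mu>"]) auto
    obtain c where c: "0 \<le> c" "\<And>x y. \<bar>?F \<mu> x - ?F \<mu> y\<bar> \<le> c * \<bar>x - y\<bar>"
      using resolvent_power_shrink_lipschitz[OF p(1) \<open>2 \<le> r\<close> \<mu>] by blast
    show "?P \<mu> \<in> frac_Sobolev0 \<Omega> s p"
    proof (rule frac_Sobolev0_lipschitz[where F = "?F \<mu>" and u = u and c = c])
      show "u \<in> frac_Sobolev0 \<Omega> s p" using u by (simp add: V_space_def)
      show "?F \<mu> \<in> borel_measurable borel" by measurable
      show "?F \<mu> 0 = 0" using s0 by simp
    qed (fact p(2) P[OF \<mu>] c)+
  qed
  have ineq: "comparison_const p r * frac_const DIM('a) p s / 2 * gagliardo s p (?P \<mu>) \<le> g (?W \<mu>)"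
    if \<mu>: "0 < \<mu>"
      and g: "g \<in> subdiff (V_space \<Omega> s p r) (V_norm \<Omega> s p r) (frac_energy_trunc \<Omega> s p r \<sigma>) u" for \<mu> g
  proof -
    define C where "C = frac_const DIM('a) p s"
    have C: "0 < C" using assms by (simp add: C_def frac_const_pos)
    define b where "b = comparison_const p r"
    note [measurable] = borel_measurable_shrink[OF \<open>2 \<le> r\<close> \<mu>] J(1)[OF \<mu>] W(1)[OF \<mu>] P(1)[OF \<mu>]
    have gd: "g \<in> dual_space (V_space \<Omega> s p r) (V_norm \<Omega> s p r)"
      and gle: "\<And>x. x \<in> V_space \<Omega> s p r \<Longrightarrow> ereal (g (\<lambda>t. x t - u t))
          \<le> frac_energy_trunc \<Omega> s p r \<sigma> x - frac_energy_trunc \<Omega> s p r \<sigma> u"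
      and "frac_energy_trunc \<Omega> s p r \<sigma> u \<noteq> \<infinity>"
      using g by (auto simp: subdiff_def)
    then have u\<sigma>: "u \<in> V_sublevel \<Omega> s p r \<sigma>" by (auto simp: frac_energy_trunc_def split: if_splits)
    \<comment> \<open>The test point is a representative of \<open>J\<^sub>\<mu>\<^sup>\<phi> u\<close>, written so that its
      difference to \<open>u\<close> is literally a multiple of \<open>\<partial>\<^sub>H\<phi>\<^sub>\<mu>(u)\<close>.\<close>
    define x where "x = (\<lambda>t. u t + (- \<mu>) * ?W \<mu> t)"
    have xm [measurable]: "x \<in> borel_measurable borel" unfolding x_def by measurable
    have xeq: "AE t in lborel. x t = shrink r \<mu> (u t)"
      using W(2)[OF \<mu>]
    proof eventually_elim
      case (elim t)
      then show ?case using shrink_eq[OF \<open>2 \<le> r\<close> \<mu>, of "u t"] by (simp add: x_def)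
    qed
    have xV: "x \<in> V_space \<Omega> s p r"
      using shrink_lipschitz[OF \<open>2 \<le> r\<close> \<mu>] shrink_0[OF \<open>2 \<le> r\<close> \<mu>]
      by (intro V_space_lipschitz[OF \<Omega> p(2) r(2) u xm xeq, of 1]) auto
    then have xr: "x \<in> Lebesgue_space \<Omega> r" by (simp add: V_space_def)
    \<comment> \<open>Shrinking moduli keeps the test point in the sublevel set, where the truncated
      energy equals the finite \<open>frac_energy\<close>.\<close>
    have "(LINT t|lborel. \<bar>x t\<bar> powr r) \<le> (LINT t|lborel. \<bar>u t\<bar> powr r)"
    proof (rule integral_mono_AE)
      show "AE t in lborel. \<bar>x t\<bar> powr r \<le> \<bar>u t\<bar> powr r"
        using xeq by eventually_elim (use abs_shrink_le[OF \<open>2 \<le> r\<close> \<mu>] r in \<open>auto intro!: powr_mono2\<close>)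
    qed (use xr ur \<Omega> in \<open>auto simp: Lebesgue_space_iff\<close>)
    then have "power_energy \<Omega> r x \<le> power_energy \<Omega> r u"
      using xr ur r by (simp add: power_energy_def Lebesgue_space_set_integral[OF \<Omega>] divide_right_mono)
    then have x\<sigma>: "x \<in> V_sublevel \<Omega> s p r \<sigma>"
      using u\<sigma> xV by (auto simp: V_sublevel_def)
    have "(\<lambda>t. x t - u t) = (\<lambda>t. - \<mu> * ?W \<mu> t)" by (simp add: x_def)
    moreover have "g (\<lambda>t. - \<mu> * ?W \<mu> t) = - \<mu> * g (?W \<mu>)"
      using gd WV[OF \<mu>] unfolding dual_space_def by blast
    ultimately have "- \<mu> * g (?W \<mu>) \<le> C / (2 * p) * gagliardo s p x - C / (2 * p) * gagliardo s p u"
      using gle[OF xV] u\<sigma> x\<sigma> by (simp add: frac_energy_trunc_def frac_energy_def C_def)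
    then have 1: "C / 2 * (gagliardo s p u / p - gagliardo s p x / p) \<le> \<mu> * g (?W \<mu>)"
      by (simp add: right_diff_distrib)
    let ?M = "gagliardo_measure s p :: ('a \<times> 'a) measure"
    have uS: "u \<in> frac_Sobolev s p" and xS: "x \<in> frac_Sobolev s p" and PS: "?P \<mu> \<in> frac_Sobolev s p"
      using u xV PW[OF \<mu>] by (auto simp: V_space_def frac_Sobolev0_def)
    \<comment> \<open>The pointwise estimate \<open>resolvent_power_shrink_diff\<close>, integrated
      against the singular kernel, bounds the energy drop from \<open>u\<close> to \<open>x\<close>
      from below.\<close>
    have "(LINT z|?M. \<mu> * b * \<bar>?P \<mu> (fst z) - ?P \<mu> (snd z)\<bar> powr p)
        \<le> (LINT z|?M. \<bar>u (fst z) - u (snd z)\<bar> powr p / p - \<bar>x (fst z) - x (snd z)\<bar> powr p / p)"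
    proof (rule integral_mono_AE)
      have "AE z in ?M. ?P \<mu> (fst z) = ?F \<mu> (u (fst z)) \<and> ?P \<mu> (snd z) = ?F \<mu> (u (snd z))"
        by (rule AE_gagliardo_measure[OF _ _ P(2)[OF \<mu>]]) measurable
      moreover have "AE z in ?M. x (fst z) = shrink r \<mu> (u (fst z)) \<and> x (snd z) = shrink r \<mu> (u (snd z))"
        by (rule AE_gagliardo_measure[OF _ _ xeq]) measurable
      ultimately show "AE z in ?M. \<mu> * b * \<bar>?P \<mu> (fst z) - ?P \<mu> (snd z)\<bar> powr p
          \<le> \<bar>u (fst z) - u (snd z)\<bar> powr p / p - \<bar>x (fst z) - x (snd z)\<bar> powr p / p"
        by eventually_elim (use resolvent_power_shrink_diff[OF p(1) \<open>2 \<le> r\<close> \<mu>] in \<open>simp add: b_def\<close>)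
    qed (use frac_Sobolev_integral(1)[OF uS] frac_Sobolev_integral(1)[OF xS] frac_Sobolev_integral(1)[OF PS] in auto)
    also have "\<dots> = gagliardo s p u / p - gagliardo s p x / p"
      using frac_Sobolev_integral[OF uS] frac_Sobolev_integral[OF xS] by simp
    finally have "\<mu> * b * gagliardo s p (?P \<mu>) \<le> gagliardo s p u / p - gagliardo s p x / p"
      by (simp add: frac_Sobolev_integral(2)[OF PS])
    then have "C / 2 * (\<mu> * b * gagliardo s p (?P \<mu>)) \<le> C / 2 * (gagliardo s p u / p - gagliardo s p x / p)"
      using C by (intro mult_left_mono) auto
    \<comment> \<open>Both the bound on the energy drop and the tested subgradient inequality carry
      one factor \<mu>; it cancels, which leaves \<beta> independent of \<mu>.\<close>
    with 1 have "\<mu> * (b * C / 2 * gagliardo s p (?P \<mu>)) \<le> \<mu> * g (?W \<mu>)"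
      by (simp add: ac_simps)
    then show ?thesis using \<mu> by (simp add: b_def C_def)
  qed
  show ?thesis
  proof (intro conjI allI impI exI[of _ "comparison_const p r"] ballI)
    show "0 < comparison_const p r" using comparison_const_pos[OF p(3) \<open>2 \<le> r\<close>] .
  qed (use JV V_space_subset_subdiff_dom[OF assms(3-5)] in blast, erule WV, erule PW, erule ineq, assumption)
qed

end
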